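(* Let $m,n\in\mathbb{N}$ and $0\le k\le\min(n-2,m)$. Suppose $\varnothing\neq P\subseteq\mathbb{R}^m$ is logarithmically dense in an $(m-k)$-dimensional linear subspace $H$ of $\mathbb{R}^m$, and $Q\subseteq\mathbb{R}^n\smallsetminus\{0\}$ satisfies: for every $C>0$ there exist two $k$-halfspheres $\Phi_1,\Phi_2\subseteq\mathbb{S}^{n-1}$, not contained in a single $k$-subsphere, such that $\Phi_1\cup\Phi_2\subseteq\overline{\pi(Q\smallsetminus B_C(0))}$. Then the collection $\mathcal L_{P,Q}=\{L_{\mathbf p,\mathbf q}:\mathbf p\in P,\mathbf q\in Q\}$ contains a totally dense subcollection; hence for every non-increasing $\psi:\mathbb{R}_{>0}\to\mathbb{R}_{>0}$ and every countable collection $\mathcal R$ of proper analytic submanifolds of $M_{m,n}$, the set $\operatorname{UA}_{P,Q}(\psi)\smallsetminus\bigcup_{R\in\mathcal R}R$ is uncountable and dense in $M_{m,n}$.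
   Context: $M_{m,n}$ is the space of real $m\times n$ matrices; $\|\cdot\|$ is the Euclidean norm, $|\cdot|$ the supremum norm, $B_C(0)$ the Euclidean ball of radius $C$ about $0$, and $\pi(\mathbf q)=\mathbf q/\|\mathbf q\|$ for $\mathbf q\in\mathbb{R}^n\smallsetminus\{0\}$. For $\mathbf p\in\mathbb{R}^m$, $\mathbf q\in\mathbb{R}^n\smallsetminus\{0\}$, $L_{\mathbf p,\mathbf q}=\{A\in M_{m,n}:A\mathbf q=\mathbf p\}$. A collection $\mathcal{L}$ of proper closed subsets of $X$ is dense if its union is dense; totally dense if dense and for every open $W$ and $L\in\mathcal L$ with $L\cap W\ne\varnothing$, the closure of $\bigcup\{L'\in\mathcal L:L'\cap L\cap W\neq\varnothing\}$ has nonempty interior. A $k$-subsphere of $\mathbb{S}^{n-1}$ is the intersection of a $(k+1)$-dimensional linear subspace of $\mathbb{R}^n$ with $\mathbb{S}^{n-1}$; a $k$-halfsphere is the intersection of $\mathbb{S}^{n-1}$ with a half-space (bounded by a $k$-dimensional linear subspace) of a $(k+1)$-dimensional linear subspace of $\mathbb{R}^n$. For $P\subseteq\mathbb{R}^m$, $\phi\in\mathbb{S}^{m-1}$, $\varepsilon>0$, let $|P|^\phi_\varepsilon=\{\|\mathbf p\|:\mathbf p\in P\smallsetminus\{0\},\ \|\mathbf p/\|\mathbf p\|-\phi\|<\varepsilon\}$. $P$ is logarithmically dense along $\phi$ if for every $\varepsilon>0$, $|P|^\phi_\varepsilon$ contains an unbounded sequence $(s_k)$ with $s_{k+1}/s_k\to1$;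 $P$ is logarithmically dense in a cone $H$ if it is logarithmically dense along every $\phi\in\mathbb{S}^{m-1}\cap H$. $\operatorname{UA}_{P,Q}(\psi)$ is the set of $A\in M_{m,n}$ such that for all sufficiently large $t$ there exist $\mathbf p\in P,\mathbf q\in Q$ with $|A\mathbf q-\mathbf p|\le\psi(t)$, $|\mathbf q|\le t$. *)

theory Defs
  imports "HOL-Analysis.Analysis"
begin

definition dense_collection :: "'a::topological_space set set \<Rightarrow> bool" where
  "dense_collection \<L> \<longleftrightarrow>
     (\<forall>L\<in>\<L>. closed L \<and> L \<noteq> UNIV) \<and> closure (\<Union>\<L>) = UNIV"

definition totally_dense :: "'a::topological_space set set \<Rightarrow> bool" where
  "totally_dense \<L> \<longleftrightarrow> dense_collection \<L> \<and>
     (\<forall>W. \<forall>L\<in>\<L>. open W \<longrightarrow> L \<inter> W \<noteq> {} \<longrightarrow>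
        interior (closure (\<Union>{L'\<in>\<L>. L' \<inter> L \<inter> W \<noteq> {}})) \<noteq> {})"

definition subsphere :: "nat \<Rightarrow> 'a::euclidean_space set \<Rightarrow> bool" where
  "subsphere k S \<longleftrightarrow> (\<exists>V. subspace V \<and> dim V = k + 1 \<and> S = V \<inter> sphere 0 1)"

text \<open>Half-spaces are taken closed; \<open>u\<close> is the inner normal within \<open>V\<close>.\<close>

definition halfsphere :: "nat \<Rightarrow> 'a::euclidean_space set \<Rightarrow> bool" where
  "halfsphere k \<Phi> \<longleftrightarrow>
     (\<exists>V u. subspace V \<and> dim V = k + 1 \<and> u \<in> V \<and> dim {x\<in>V. u \<bullet> x = 0} = k \<and>
            \<Phi> = {x\<in>V. u \<bullet> x \<ge> 0} \<inter> sphere 0 1)"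

text \<open>On nonzero vectors, \<open>sgn x\<close> is the radial projection \<open>x /\<^sub>R norm x\<close> to the unit sphere.\<close>

definition norms_along :: "'a::euclidean_space set \<Rightarrow> 'a \<Rightarrow> real \<Rightarrow> real set" where
  "norms_along P \<phi> \<epsilon> = norm ` {p \<in> P - {0}. norm (sgn p - \<phi>) < \<epsilon>}"

definition log_dense_along :: "'a::euclidean_space set \<Rightarrow> 'a \<Rightarrow> bool" where
  "log_dense_along P \<phi> \<longleftrightarrow>
     (\<forall>\<epsilon>>0. \<exists>s :: nat \<Rightarrow> real. range s \<subseteq> norms_along P \<phi> \<epsilon> \<and> \<not> bounded (range s) \<and>
        (\<lambda>i. s (Suc i) / s i) \<longlonglongrightarrow> 1)"

definition log_dense_in :: "'a::euclidean_space set \<Rightarrow> 'a set \<Rightarrow> bool" where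
  "log_dense_in P H \<longleftrightarrow> (\<forall>\<phi> \<in> sphere 0 1 \<inter> H. log_dense_along P \<phi>)"

definition mat_fibre :: "real^'m \<Rightarrow> real^'n \<Rightarrow> (real^'n^'m) set" where
  "mat_fibre p q = {A. A *v q = p}"

definition mat_fibres :: "(real^'m) set \<Rightarrow> (real^'n) set \<Rightarrow> (real^'n^'m) set set" where
  "mat_fibres P Q = {mat_fibre p q | p q. p \<in> P \<and> q \<in> Q}"

definition UA :: "(real^'m) set \<Rightarrow> (real^'n) set \<Rightarrow> (real \<Rightarrow> real) \<Rightarrow> (real^'n^'m) set" where
  "UA P Q \<psi> = {A. \<forall>\<^sub>F t in at_top. \<exists>p\<in>P. \<exists>q\<in>Q. infnorm (A *v q - p) \<le> \<psi> t \<and> infnorm q \<le> t}"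

text \<open>
  Real-analyticity in several variables: near every point, \<open>f\<close> is the sum of a convergent power
  series. The multi-indices are the extensional functions \<open>\<alpha>\<close> from \<open>Basis\<close> to the naturals.
\<close>

definition real_analytic_on ::
    "('a::euclidean_space \<Rightarrow> 'b::euclidean_space) \<Rightarrow> 'a set \<Rightarrow> bool" where
  "real_analytic_on f U \<longleftrightarrow>
     (\<forall>x\<in>U. \<exists>c. \<exists>r>0. \<forall>y\<in>ball x r.
        ((\<lambda>\<alpha> :: 'a \<Rightarrow> nat. (\<Prod>b\<in>Basis. ((y - x) \<bullet> b) ^ \<alpha> b) *\<^sub>R c \<alpha>) has_sum f y)
          (Basis \<rightarrow>\<^sub>E UNIV))"

text \<open>Embedded submanifolds, through slice charts; they need not be closed.\<close>

definition analytic_submanifold :: "nat \<Rightarrow> 'a::euclidean_space set \<Rightarrow> bool" where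
  "analytic_submanifold d R \<longleftrightarrow>
     (\<forall>x\<in>R. \<exists>U (V :: 'a set) h g T. open U \<and> x \<in> U \<and> open V \<and> homeomorphism U V h g \<and>
        real_analytic_on h U \<and> real_analytic_on g V \<and>
        subspace T \<and> dim T = d \<and> h ` (U \<inter> R) = V \<inter> T)"

text \<open>
  ``Proper'' has to mean positive codimension: nonempty open sets are submanifolds of full dimension,
  and countably many proper ones cover the space. A closed submanifold which is a proper subset of
  the space has positive codimension (or is empty), so that reading is included.
\<close>

definition proper_analytic_submanifold :: "'a::euclidean_space set \<Rightarrow> bool" where
  "proper_analytic_submanifold R \<longleftrightarrow> (\<exists>d < DIM('a). analytic_submanifold d R)"

end

theory Submission
  imports Defs "HOL-Complex_Analysis.Cauchy_Integral_Formula"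
begin

text \<open>
  Let \<open>p'\<close> and \<open>q'\<close> be such that \<open>q'\<close> is long, points almost in a direction \<open>\<theta>\<close>, and
  \<open>p' / norm q'\<close> is close to \<open>A *v \<theta>\<close>. Then the fibre \<open>mat_fibre p' q'\<close> passes close to \<open>A\<close>, and it
  meets \<open>mat_fibre p q\<close> close to \<open>A\<close> as long as the angle between \<open>\<theta>\<close> and \<open>q\<close> is bounded below and
  \<open>A\<close> is close to \<open>mat_fibre p q\<close>. Logarithmic density of \<open>P\<close> provides \<open>p'\<close> as soon as \<open>A *v \<theta>\<close>
  lies in \<open>H\<close>, and since \<open>H\<close> has codimension \<open>k\<close>, every subspace of dimension \<open>k + 1\<close> contains such
  a \<open>\<theta>\<close>. As \<open>\<theta>\<close> and \<open>-\<theta>\<close> serve equally well, halfspheres are as good as spheres.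

  By compactness some subspace \<open>V\<close> of dimension \<open>k + 1\<close> consists of limit directions of \<open>Q\<close> at
  infinity. If there are two of them, discard from \<open>Q\<close> their intersection; if there is only one,
  discard \<open>V\<close> itself: the second halfsphere ensures that enough of \<open>Q\<close> is left. Afterwards each
  \<open>q\<close> has a subspace of limit directions which misses it, so that the angles are bounded below and
  the fibres that meet \<open>mat_fibre p q\<close> near a point \<open>A\<^sub>0\<close> of it are dense in a neighbourhood of
  \<open>A\<^sub>0\<close>.

  A matrix in \<open>UA P Q \<psi>\<close> is the limit of a sequence of nested balls whose centres move from fibre to
  fibre through their intersections. A submanifold is avoided on the way because an
  analytic function that vanishes near one point of a fibre vanishes along the fibre, whereas the
  available fibres fill an open set. Adding singletons to the submanifolds gives uncountability.
\<close>

subsection \<open>Zero sets of analytic functions\<close>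

text \<open>Along a line, the monomial with multi-index \<alpha> becomes a constant times the power
  of \<open>t - t0\<close> whose exponent is the total degree of \<alpha>. Grouping the unordered
  sum by total degree yields an ordinary power series.\<close>

lemma real_analytic_on_line:
  fixes f :: "'a::euclidean_space \<Rightarrow> 'b::euclidean_space"
  assumes f: "real_analytic_on f U" and x: "x + t0 *\<^sub>R v \<in> U"
  shows "\<exists>a. \<exists>r>0. \<forall>t. norm (t - t0) < r \<longrightarrow>
    (\<lambda>n. a n * (t - t0) ^ n) sums (f (x + t *\<^sub>R v) \<bullet> \<nu>)"
proof -
  define y0 where "y0 = x + t0 *\<^sub>R v"
  have "\<exists>c. \<exists>R>0. \<forall>y\<in>ball y0 R.
      ((\<lambda>\<alpha> :: 'a \<Rightarrow> nat. (\<Prod>b\<in>Basis. ((y - y0) \<bullet> b) ^ \<alpha> b) *\<^sub>R c \<alpha>) has_sum f y) (Basis \<rightarrow>\<^sub>E UNIV)"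
    using f x unfolding real_analytic_on_def y0_def by (rule bspec)
  then obtain c R where R: "R > 0" and sumf: "\<forall>y\<in>ball y0 R.
      ((\<lambda>\<alpha> :: 'a \<Rightarrow> nat. (\<Prod>b\<in>Basis. ((y - y0) \<bullet> b) ^ \<alpha> b) *\<^sub>R c \<alpha>) has_sum f y) (Basis \<rightarrow>\<^sub>E UNIV)"
    by (elim exE conjE) (rule that)
  \<comment> \<open>\<open>B n\<close> collects the multi-indices of total degree \<open>n\<close>.
    It is finite because each component is at most the total.\<close>
  define B :: "nat \<Rightarrow> ('a \<Rightarrow> nat) set" where "B n = {\<alpha> \<in> Basis \<rightarrow>\<^sub>E UNIV. sum \<alpha> Basis = n}" for n
  define w where "w \<alpha> = (\<Prod>b\<in>Basis. (v \<bullet> b) ^ \<alpha> b) * (c \<alpha> \<bullet> \<nu>)" for \<alpha> :: "'a \<Rightarrow> nat"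
  have finB: "finite (B n)" for n
  proof (rule finite_subset)
    show "B n \<subseteq> Basis \<rightarrow>\<^sub>E {..n}"
    proof
      fix \<alpha> assume \<alpha>: "\<alpha> \<in> B n"
      then have "\<alpha> b \<le> n" if "b \<in> Basis" for b
        using member_le_sum[OF that, of \<alpha>] by (simp add: B_def)
      with \<alpha> show "\<alpha> \<in> Basis \<rightarrow>\<^sub>E {..n}"
        by (simp add: B_def PiE_iff)
    qed
    show "finite (Basis \<rightarrow>\<^sub>E {..n} :: ('a \<Rightarrow> nat) set)"
      by (intro finite_PiE) auto
  qed
  \<comment> \<open>The summand 1 covers the degenerate direction \<open>v = 0\<close>.\<close>
  define r where "r = R / (norm v + 1)"
  have "r > 0"
    using R by (simp add: r_def add_nonneg_pos)
  moreover have "(\<lambda>n. (\<Sum>\<alpha>\<in>B n. w \<alpha>) * (t - t0) ^ n) sums (f (x + t *\<^sub>R v) \<bullet> \<nu>)"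
    if t: "norm (t - t0) < r" for t
  proof -
    define \<tau> where "\<tau> = t - t0"
    define y where "y = x + t *\<^sub>R v"
    have yy: "y - y0 = \<tau> *\<^sub>R v"
      by (simp add: y_def y0_def \<tau>_def algebra_simps)
    have "\<bar>\<tau>\<bar> * norm v \<le> \<bar>\<tau>\<bar> * (norm v + 1)"
      by (simp add: mult_left_mono)
    also have "\<dots> < R"
      using t by (simp add: r_def \<tau>_def pos_less_divide_eq add_nonneg_pos)
    finally have "norm (y - y0) < R"
      using yy by simp
    then have "y \<in> ball y0 R"
      by (simp add: dist_norm norm_minus_commute)
    from has_sum_bounded_linear[OF bounded_linear_inner_left bspec[OF sumf this], of \<nu>]
    have "((\<lambda>\<alpha>. (\<Prod>b\<in>Basis. (\<tau> * (v \<bullet> b)) ^ \<alpha> b) * (c \<alpha> \<bullet> \<nu>)) has_sum f y \<bullet> \<nu>) (Basis \<rightarrow>\<^sub>E UNIV)"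
      by (simp add: yy)
    also have "(\<lambda>\<alpha>. (\<Prod>b\<in>Basis. (\<tau> * (v \<bullet> b)) ^ \<alpha> b) * (c \<alpha> \<bullet> \<nu>)) = (\<lambda>\<alpha>. w \<alpha> * \<tau> ^ sum \<alpha> Basis)"
      unfolding w_def power_mult_distrib prod.distrib power_sum by (simp only: mult_ac)
    \<comment> \<open>Tagging each multi-index with its degree makes the index set a disjoint union
      of the finite sets \<open>B n\<close>, so that the inner sums can be taken first.\<close>
    also have "(\<dots> has_sum f y \<bullet> \<nu>) (Basis \<rightarrow>\<^sub>E UNIV) \<longleftrightarrow>
        ((\<lambda>(n, \<alpha>). w \<alpha> * \<tau> ^ n) has_sum f y \<bullet> \<nu>) (Sigma UNIV B)"
      by (rule has_sum_reindex_bij_witness[of _ snd "\<lambda>\<alpha>. (sum \<alpha> Basis, \<alpha>)"]) (auto simp: B_def)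
    finally have "((\<lambda>(n, \<alpha>). w \<alpha> * \<tau> ^ n) has_sum f y \<bullet> \<nu>) (Sigma UNIV B)" .
    then have "((\<lambda>n. \<Sum>\<alpha>\<in>B n. w \<alpha> * \<tau> ^ n) has_sum f y \<bullet> \<nu>) UNIV"
      by (rule has_sum_SigmaD) (simp add: finB)
    then show ?thesis
      by (intro has_sum_imp_sums) (simp add: y_def \<tau>_def sum_distrib_right)
  qed
  ultimately show ?thesis
    by (intro exI[of _ "\<lambda>n. \<Sum>\<alpha>\<in>B n. w \<alpha>"] exI[of _ r] conjI allI impI)
qed

text \<open>If some coefficient of positive degree is nonzero, then \<open>t0\<close> is either an
  isolated zero or a point where the limit \<open>a 0\<close> is nonzero. Otherwise \<open>g\<close>
  is constant near \<open>t0\<close>.\<close>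

lemma power_series_zero_dichotomy:
  fixes g :: "real \<Rightarrow> real"
  assumes r: "r > 0" and a: "\<And>t. norm (t - t0) < r \<Longrightarrow> (\<lambda>n. a n * (t - t0) ^ n) sums g t"
  shows "(\<exists>\<rho>>0. \<forall>u. \<bar>u - t0\<bar> < \<rho> \<longrightarrow> g u = 0) \<or> (\<exists>\<rho>>0. \<forall>u. 0 < \<bar>u - t0\<bar> \<and> \<bar>u - t0\<bar> < \<rho> \<longrightarrow> g u \<noteq> 0)"
proof (cases "\<exists>m>0. a m \<noteq> 0")
  case True
  then obtain m where m: "a m \<noteq> 0" "m > 0" by blast
  have g0: "g t0 = a 0"
    using a[of t0] r by simp
  show ?thesis
  proof (cases "a 0 = 0")
    case True
    obtain s where "0 < s" "\<And>z. z \<in> cball t0 s - {t0} \<Longrightarrow> g z \<noteq> 0"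
      using powser_0_nonzero[OF r a _ m] True g0 by auto
    then have "\<forall>u. 0 < \<bar>u - t0\<bar> \<and> \<bar>u - t0\<bar> < s \<longrightarrow> g u \<noteq> 0"
      by (auto simp: dist_real_def)
    then show ?thesis using \<open>0 < s\<close> by blast
  next
    case False
    have "(g \<longlongrightarrow> a 0) (at t0)"
    proof -
      have "((\<lambda>x. g (x + t0)) \<longlongrightarrow> a 0) (at 0)"
        using powser_limit_0[OF r, of a "\<lambda>x. g (x + t0)"] a[of "_ + t0"] by simp
      then show ?thesis
        by (subst LIM_offset_zero_iff[of t0]) (auto simp: add.commute)
    qed
    then have "\<forall>\<^sub>F u in at t0. g u \<noteq> 0"
      using False tendsto_imp_eventually_ne by blast
    then show ?thesis
      unfolding eventually_at dist_real_def by auto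
  qed
next
  case False
  have eq: "g u = a 0" if "\<bar>u - t0\<bar> < r" for u
  proof -
    have "(\<lambda>n. a n * (u - t0) ^ n) = (\<lambda>n. if n = 0 then a 0 else 0)"
      using False by (intro ext) (metis gr0I mult_eq_0_iff mult.right_neutral power_0)
    then have "(\<lambda>n. a n * (u - t0) ^ n) sums a 0"
      using sums_single[of 0 "\<lambda>_. a 0"] by simp
    then show ?thesis
      using a[of u] that sums_unique2 by auto
  qed
  then show ?thesis
    using r by (cases "a 0 = 0") auto
qed

text \<open>The identity theorem on a segment. The points near which \<open>g\<close> vanishes
  (\<open>S\<close>) and those with a punctured neighbourhood free of zeros (\<open>T\<close>) form
  disjoint open sets covering the connected interval from 0 to 1. If \<open>g\<close> vanished right
  after 0, all of the interval would lie in \<open>S\<close>, including its end point.\<close>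

lemma analytic_nonzero_near_start:
  fixes f :: "'a::euclidean_space \<Rightarrow> 'b::euclidean_space"
  assumes f: "real_analytic_on f U" and seg: "closed_segment x y \<subseteq> U"
    and y: "f y \<bullet> \<nu> \<noteq> 0" and e: "e > 0"
  shows "\<exists>s. 0 < s \<and> s < e \<and> f (x + s *\<^sub>R (y - x)) \<bullet> \<nu> \<noteq> 0"
proof (rule ccontr)
  define g where "g t = f (x + t *\<^sub>R (y - x)) \<bullet> \<nu>" for t
  assume "\<not> ?thesis"
  then have z: "g s = 0" if "0 < s" "s < e" for s
    using that by (auto simp: g_def)
  define S where "S = {t. \<exists>\<rho>>0. \<forall>u. \<bar>u - t\<bar> < \<rho> \<longrightarrow> g u = 0}"
  define T where "T = {t. \<exists>\<rho>>0. \<forall>u. 0 < \<bar>u - t\<bar> \<and> \<bar>u - t\<bar> < \<rho> \<longrightarrow> g u \<noteq> 0}"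
  have ST: "t \<in> S \<or> t \<in> T" if "t \<in> {0..1}" for t
  proof -
    have "x + t *\<^sub>R (y - x) \<in> U"
      using seg that by (force simp: in_segment algebra_simps)
    then have "\<exists>a. \<exists>r>0. \<forall>s. norm (s - t) < r \<longrightarrow> (\<lambda>n. a n * (s - t) ^ n) sums g s"
      unfolding g_def by (rule real_analytic_on_line[OF f])
    then obtain a r where "r > 0" "\<forall>s. norm (s - t) < r \<longrightarrow> (\<lambda>n. a n * (s - t) ^ n) sums g s"
      by (elim exE conjE) (rule that)
    from power_series_zero_dichotomy[OF this(1) mp[OF spec[OF this(2)]]] show ?thesis
      unfolding S_def T_def by simp
  qed
  have "open S"
    unfolding open_dist
  proof
    fix t assume "t \<in> S"
    then obtain \<rho> where \<rho>: "\<rho> > 0" "\<And>u. \<bar>u - t\<bar> < \<rho> \<Longrightarrow> g u = 0" by (auto simp: S_def)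
    have "s \<in> S" if "dist s t < \<rho>" for s
      unfolding S_def mem_Collect_eq
      by (rule exI[of _ "\<rho> - dist s t"]) (use that \<rho> in \<open>auto simp: dist_real_def\<close>)
    with \<rho> show "\<exists>e>0. \<forall>s. dist s t < e \<longrightarrow> s \<in> S" by blast
  qed
  have "open T"
    unfolding open_dist
  proof
    fix t assume "t \<in> T"
    then obtain \<rho> where \<rho>: "\<rho> > 0" "\<And>u. 0 < \<bar>u - t\<bar> \<and> \<bar>u - t\<bar> < \<rho> \<Longrightarrow> g u \<noteq> 0"
      by (auto simp: T_def)
    have "s \<in> T" if "dist s t < \<rho>" for s
    proof (cases "s = t")
      case False
      define \<sigma> where "\<sigma> = min (\<rho> - dist s t) (dist s t)"
      have "g u \<noteq> 0" if "\<bar>u - s\<bar> < \<sigma>" for u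
        by (rule \<rho>(2)) (use that in \<open>auto simp: \<sigma>_def dist_real_def\<close>)
      moreover have "\<sigma> > 0" using False \<open>dist s t < \<rho>\<close> by (simp add: \<sigma>_def)
      ultimately show ?thesis unfolding T_def by blast
    qed (use \<open>t \<in> T\<close> in auto)
    with \<rho> show "\<exists>e>0. \<forall>s. dist s t < e \<longrightarrow> s \<in> T" by blast
  qed
  have disj: "S \<inter> T = {}"
  proof -
    have False if "t \<in> S" "t \<in> T" for t
    proof -
      obtain \<rho> where \<rho>: "\<rho> > 0" "\<And>u. \<bar>u - t\<bar> < \<rho> \<Longrightarrow> g u = 0"
        using \<open>t \<in> S\<close> unfolding S_def by blast
      obtain \<sigma> where \<sigma>: "\<sigma> > 0" "\<And>u. 0 < \<bar>u - t\<bar> \<and> \<bar>u - t\<bar> < \<sigma> \<Longrightarrow> g u \<noteq> 0"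
        using \<open>t \<in> T\<close> unfolding T_def by blast
      define m where "m = min \<rho> \<sigma> / 2"
      have "0 < m" "m < \<rho>" "m < \<sigma>" using \<rho>(1) \<sigma>(1) by (auto simp: m_def min_def)
      then show False
        using \<rho>(2)[of "t + m"] \<sigma>(2)[of "t + m"] by auto
    qed
    then show ?thesis by blast
  qed
  \<comment> \<open>Zeros on the right of 0 alone already rule out a punctured neighbourhood without
    zeros.\<close>
  have "0 \<notin> T"
  proof
    assume "0 \<in> T"
    then obtain \<sigma> where *: "\<sigma> > 0" "\<And>u. 0 < \<bar>u - 0\<bar> \<and> \<bar>u - 0\<bar> < \<sigma> \<Longrightarrow> g u \<noteq> 0"
      by (auto simp: T_def)
    define m where "m = min e \<sigma> / 2"
    have "0 < m" "m < e" "m < \<sigma>" using *(1) e by (auto simp: m_def min_def)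
    then show False
      using *(2)[of m] z[of m] by auto
  qed
  then have "0 \<in> S" using ST[of 0] by auto
  have "S \<inter> {0..1} = {} \<or> T \<inter> {0..1} = {}"
    by (rule connectedD[OF connected_Icc \<open>open S\<close> \<open>open T\<close>]) (use disj ST in blast)+
  then have "T \<inter> {0..1} = {}"
    using \<open>0 \<in> S\<close> by (metis IntI atLeastAtMost_iff emptyE order_refl zero_le_one)
  then have "1 \<in> S" using ST[of 1] by auto
  then have "g 1 = 0" by (auto simp: S_def)
  with y show False by (simp add: g_def)
qed

text \<open>
  A set \<open>Z\<close> is thin if every segment from a point of \<open>Z\<close> towards a point of \<open>D\<close> leaves \<open>Z\<close>
  at arbitrarily small times; this is all that is used of analytic sets of positive codimension.
\<close>

definition thin :: "'a::euclidean_space set \<Rightarrow> bool" where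
  "thin Z \<longleftrightarrow> closed Z \<and> (\<exists>D. open D \<and> Z \<subseteq> closure D \<and>
     (\<forall>x\<in>Z. \<forall>y\<in>D. \<forall>e>0. \<exists>s. 0 < s \<and> s < e \<and> x + s *\<^sub>R (y - x) \<notin> Z))"

text \<open>The complement of a point serves as \<open>D\<close>: it is dense, and a segment towards
  another point leaves \<open>x\<close> at once.\<close>

lemma thin_singleton: "thin {x :: 'a::euclidean_space}"
proof -
  have "{x} \<subseteq> closure (- {x})"
    by (simp add: closure_complement interior_singleton)
  moreover have "\<exists>s. 0 < s \<and> s < e \<and> x + s *\<^sub>R (y - x) \<notin> {x}" if "y \<noteq> x" "e > 0" for y and e :: real
    using that by (intro exI[of _ "e / 2"]) auto
  ultimately show ?thesis
    unfolding thin_def by (intro conjI exI[of _ "- {x}"]) (auto simp del: insert_subset)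
qed

text \<open>The nonzero set in the open ball serves as \<open>D\<close>. It is dense because
  \<open>h\<close> is an open map and no nonempty open set lies in the hyperplane normal to \<nu>.
  Balls are convex, so the identity theorem applies on each segment.\<close>

lemma thin_zero_set:
  fixes h :: "'a::euclidean_space \<Rightarrow> 'a"
  assumes an: "real_analytic_on h U" and hom: "homeomorphism U V h g" and V: "open V"
    and cb: "cball x r \<subseteq> U" "r > 0" and \<nu>: "\<nu> \<noteq> 0"
  shows "thin {y \<in> cball x r. h y \<bullet> \<nu> = 0}"
proof -
  define Z where "Z = {y \<in> cball x r. h y \<bullet> \<nu> = 0}"
  define D where "D = {y \<in> ball x r. h y \<bullet> \<nu> \<noteq> 0}"
  have cont: "continuous_on (cball x r) (\<lambda>y. h y \<bullet> \<nu>)"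
    using hom cb by (intro continuous_intros) (auto simp: homeomorphism_def intro: continuous_on_subset)
  have "closed Z"
    unfolding Z_def by (rule continuous_closed_preimage_constant[OF cont]) auto
  have "open D"
  proof -
    have "open (ball x r \<inter> (\<lambda>y. h y \<bullet> \<nu>) -` (- {0}))"
      by (rule continuous_open_preimage)
        (auto intro: continuous_on_subset[OF cont] simp: ball_subset_cball)
    then show ?thesis by (auto simp: D_def vimage_def Int_def)
  qed
  have dense: "ball x r \<subseteq> closure D"
  proof (rule ccontr)
    define O' where "O' = ball x r - closure D"
    assume "\<not> ball x r \<subseteq> closure D"
    then have "O' \<noteq> {}" "open O'" by (auto simp: O'_def)
    have sub: "O' \<subseteq> U" using cb ball_subset_cball[of x r] unfolding O'_def by blast
    have "openin (top_of_set U) O'"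
      using \<open>open O'\<close> sub by (simp add: open_subset)
    then have "openin (top_of_set V) (h ` O')"
      by (rule homeomorphism_imp_open_map[OF hom])
    then have op: "open (h ` O')"
      using V openin_open_eq by blast
    obtain z where z: "z \<in> O'" using \<open>O' \<noteq> {}\<close> by blast
    then obtain \<epsilon> where \<epsilon>: "\<epsilon> > 0" "ball (h z) \<epsilon> \<subseteq> h ` O'"
      using op by (meson imageI open_contains_ball)
    \<comment> \<open>A short step from \<open>h z\<close> along \<nu>: it stays in the open image
      but leaves the hyperplane.\<close>
    define w where "w = h z + (\<epsilon> / (2 * norm \<nu>)) *\<^sub>R \<nu>"
    have "w \<in> ball (h z) \<epsilon>" using \<epsilon> \<nu> by (simp add: w_def dist_norm)
    then obtain z' where z': "z' \<in> O'" "w = h z'" using \<epsilon> by blast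
    have zero: "h y \<bullet> \<nu> = 0" if "y \<in> O'" for y
      using that closure_subset[of D] by (auto simp: O'_def D_def)
    have "w \<bullet> \<nu> = (\<epsilon> / (2 * norm \<nu>)) * (\<nu> \<bullet> \<nu>)"
      using zero[OF z] by (simp add: w_def inner_add_left)
    then show False
      using zero[OF z'(1)] z'(2) \<epsilon> \<nu> by simp
  qed
  have "Z \<subseteq> closure D"
  proof -
    have "Z \<subseteq> closure (ball x r)" using cb by (auto simp: Z_def)
    also have "\<dots> \<subseteq> closure D" using dense by (simp add: closure_minimal)
    finally show ?thesis .
  qed
  moreover have "\<exists>s. 0 < s \<and> s < e \<and> z + s *\<^sub>R (y - z) \<notin> Z" if "z \<in> Z" "y \<in> D" "e > 0" for z y e
  proof -
    have "closed_segment z y \<subseteq> cball x r"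
      using that by (intro closed_segment_subset) (auto simp: Z_def D_def)
    then have "closed_segment z y \<subseteq> U" using cb by blast
    from analytic_nonzero_near_start[OF an this _ \<open>e > 0\<close>, of \<nu>] that
    obtain s where "0 < s" "s < e" "h (z + s *\<^sub>R (y - z)) \<bullet> \<nu> \<noteq> 0" by (auto simp: D_def)
    then show ?thesis by (auto simp: Z_def)
  qed
  ultimately show ?thesis
    using \<open>closed Z\<close> \<open>open D\<close> unfolding thin_def Z_def by blast
qed

text \<open>A slice chart maps the submanifold locally into a proper subspace, hence into a
  hyperplane, whose preimage in a small closed ball is thin. Countably many of the balls suffice by
  Lindelof.\<close>

lemma proper_analytic_submanifold_thin_cover:
  fixes R :: "'a::euclidean_space set"
  assumes "proper_analytic_submanifold R"
  obtains \<Z> where "countable \<Z>" "\<And>Z. Z \<in> \<Z> \<Longrightarrow> thin Z" "R \<subseteq> \<Union>\<Z>"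
proof -
  obtain d where d: "d < DIM('a)" "analytic_submanifold d R"
    using assms by (auto simp: proper_analytic_submanifold_def)
  have "\<exists>r Z. r > 0 \<and> thin Z \<and> R \<inter> ball x r \<subseteq> Z" if "x \<in> R" for x
  proof -
    obtain U and V :: "'a set" and h g T where *: "open U" "x \<in> U" "open V" "homeomorphism U V h g"
        "real_analytic_on h U" "subspace T" "dim T = d" "h ` (U \<inter> R) = V \<inter> T"
      using d(2)[unfolded analytic_submanifold_def, rule_format, OF \<open>x \<in> R\<close>] by (elim exE conjE) (rule that)
    obtain \<nu> where \<nu>: "\<nu> \<noteq> 0" "\<And>y. y \<in> span T \<Longrightarrow> orthogonal \<nu> y"
      using orthogonal_to_subspace_exists[of T] d(1) *(7) by auto
    obtain r where r: "r > 0" "cball x r \<subseteq> U"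
      using *(1,2) open_contains_cball by blast
    have "h y \<bullet> \<nu> = 0" if "y \<in> R" "y \<in> ball x r" for y
    proof -
      have "y \<in> U" using that r ball_subset_cball[of x r] by blast
      then have "h y \<in> T" using that *(8) by blast
      then show ?thesis using \<nu>(2)[of "h y"] by (simp add: span_base orthogonal_def inner_commute)
    qed
    then have "R \<inter> ball x r \<subseteq> {y \<in> cball x r. h y \<bullet> \<nu> = 0}" by auto
    then show ?thesis
      using thin_zero_set[OF *(5,4,3) r(2,1) \<nu>(1)] r(1) by blast
  qed
  then obtain r Z where rZ: "\<And>x. x \<in> R \<Longrightarrow> r x > 0 \<and> thin (Z x) \<and> R \<inter> ball x (r x) \<subseteq> Z x"
    by metis
  obtain \<F> where F: "\<F> \<subseteq> (\<lambda>x. ball x (r x)) ` R" "countable \<F>" "\<Union>\<F> = (\<Union>x\<in>R. ball x (r x))"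
    using Lindelof[of "(\<lambda>x. ball x (r x)) ` R"] by auto
  obtain R' where R': "R' \<subseteq> R" "countable R'" "\<F> = (\<lambda>x. ball x (r x)) ` R'"
    using F by (meson countable_subset_image)
  have "R \<subseteq> \<Union>(Z ` R')"
  proof
    fix x assume x: "x \<in> R"
    then have "x \<in> ball x (r x)" using rZ by simp
    then have "x \<in> \<Union>\<F>" using F(3) x by blast
    then obtain x' where "x' \<in> R'" "x \<in> ball x' (r x')" using R' by blast
    then show "x \<in> \<Union>(Z ` R')" using x rZ[of x'] R' by blast
  qed
  then show ?thesis
    using that[of "Z ` R'"] R' rZ by blast
qed

subsection \<open>Limit directions\<close>

text \<open>Directions are taken up to sign, which turns the halfspheres into full spheres.\<close>

definition approximates :: "'a::euclidean_space set \<Rightarrow> real \<Rightarrow> 'a set \<Rightarrow> bool" where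
  "approximates Q C V \<longleftrightarrow> (\<forall>\<theta>\<in>V. norm \<theta> = 1 \<longrightarrow>
     (\<forall>\<eta>>0. \<exists>q\<in>Q. norm q \<ge> C \<and> (norm (sgn q - \<theta>) < \<eta> \<or> norm (sgn q + \<theta>) < \<eta>)))"

lemma approximates_mono: "approximates Q' C V \<Longrightarrow> Q' \<subseteq> Q \<Longrightarrow> approximates Q C V"
  unfolding approximates_def by blast

text \<open>A halfsphere and its antipodal image together cover the unit sphere of the subspace that
  it spans.\<close>

lemma halfsphere_approximates:
  assumes "halfsphere k \<Phi>" and "\<Phi> \<subseteq> closure (sgn ` (Q - ball 0 C))"
  obtains V where "subspace V" "dim V = k + 1" "\<Phi> \<subseteq> V \<inter> sphere 0 1" "approximates Q C V"
proof -
  obtain V u where V: "subspace V" "dim V = k + 1" "\<Phi> = {x\<in>V. u \<bullet> x \<ge> 0} \<inter> sphere 0 1"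
    using assms(1) unfolding halfsphere_def by blast
  have near: "\<exists>q\<in>Q. norm q \<ge> C \<and> norm (sgn q - \<theta>) < \<eta>" if "\<theta> \<in> \<Phi>" "\<eta> > 0" for \<theta> \<eta>
  proof -
    have "\<theta> \<in> closure (sgn ` (Q - ball 0 C))" using \<open>\<theta> \<in> \<Phi>\<close> assms(2) by blast
    then have "\<exists>y\<in>sgn ` (Q - ball 0 C). dist y \<theta> < \<eta>"
      using \<open>\<eta> > 0\<close> unfolding closure_approachable by simp
    then obtain q where "q \<in> Q - ball 0 C" "dist (sgn q) \<theta> < \<eta>" by (rule bexE) (erule imageE, simp)
    then show ?thesis by (intro bexI[of _ q]) (auto simp: dist_norm)
  qed
  have "approximates Q C V"
    unfolding approximates_def
  proof (intro ballI impI allI)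
    fix \<theta> and \<eta> :: real
    assume *: "\<theta> \<in> V" "norm \<theta> = 1" "\<eta> > 0"
    then have "\<theta> \<in> \<Phi> \<or> - \<theta> \<in> \<Phi>"
      using V subspace_neg[of V \<theta>] by auto
    then show "\<exists>q\<in>Q. norm q \<ge> C \<and> (norm (sgn q - \<theta>) < \<eta> \<or> norm (sgn q + \<theta>) < \<eta>)"
      using near[of \<theta> \<eta>] near[of "- \<theta>" \<eta>] *(3) by auto
  qed
  then show ?thesis
    using that V by blast
qed

text \<open>Sequential compactness of the Grassmannian: orthonormal bases converge along a
  subsequence, and their limits are orthonormal again. A vector of \<open>W\<close> is approached by
  the vectors with the same coordinates in the approximating bases.\<close>

lemma subspaces_subsequence_limit:
  fixes V :: "nat \<Rightarrow> 'a::euclidean_space set"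
  assumes V: "\<And>n. subspace (V n)" "\<And>n. dim (V n) = d"
  obtains W r where "strict_mono (r :: nat \<Rightarrow> nat)" "subspace W" "dim W = d"
    "\<And>\<theta>. \<theta> \<in> W \<Longrightarrow> \<exists>x. x \<longlonglongrightarrow> \<theta> \<and> (\<forall>n. x n \<in> V (r n))"
proof -
  have "\<exists>b. b ` {..<d} \<subseteq> V n \<and> (\<forall>i<d. \<forall>j<d. b i \<bullet> b j = (if i = j then 1 else 0))" for n
  proof -
    obtain B where B: "B \<subseteq> V n" "pairwise orthogonal B" "\<And>x. x \<in> B \<Longrightarrow> norm x = 1"
      "independent B" "card B = d"
      using orthonormal_basis_subspace[OF V(1)[of n]] V(2) by metis
    obtain b where b: "bij_betw b {..<d} B"
      using ex_bij_betw_nat_finite[of B] B(4,5) independent_imp_finite atLeast0LessThan by metis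
    have "b i \<bullet> b j = (if i = j then 1 else 0)" if "i < d" "j < d" for i j
    proof -
      have bB: "b i \<in> B" "b j \<in> B" using b that by (auto simp: bij_betw_def)
      show ?thesis
      proof (cases "i = j")
        case False
        then have "b i \<noteq> b j" using b that by (auto simp: bij_betw_def inj_on_def)
        then show ?thesis using B(2) bB False by (auto simp: pairwise_def orthogonal_def)
      qed (use B(3)[OF bB(1)] in \<open>simp add: dot_square_norm\<close>)
    qed
    moreover have "b ` {..<d} \<subseteq> V n" using B(1) b by (auto simp: bij_betw_def)
    ultimately show ?thesis by blast
  qed
  then obtain e where e: "\<And>n. e n ` {..<d} \<subseteq> V n"
      "\<And>n i j. i < d \<Longrightarrow> j < d \<Longrightarrow> e n i \<bullet> e n j = (if i = j then 1 else (0::real))"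
    by metis
  have n1: "norm (e n i) = 1" if "i < d" for n i
    using e(2)[OF that that, of n] by (simp add: norm_eq_1)
  have bd: "bounded ((\<lambda>x. x i) ` range e)" if "i \<in> {..<d}" for i
    unfolding bounded_iff using n1 that by (intro exI[of _ 1]) auto
  \<comment> \<open>Bolzano-Weierstrass for all \<open>d\<close> basis vectors at once.\<close>
  have "\<exists>l r. strict_mono r \<and>
      (\<forall>\<epsilon>>0. \<forall>\<^sub>F n in sequentially. \<forall>i\<in>{..<d}. dist (e (r n) i) (l i) < \<epsilon>)"
    using compact_lemma_general[of "{..<d}" "\<lambda>x i. x i" e "\<lambda>x. x"] bd by blast
  then obtain l r where r: "strict_mono (r :: nat \<Rightarrow> nat)"
    and l: "\<And>\<epsilon>. \<epsilon> > 0 \<Longrightarrow> \<forall>\<^sub>F n in sequentially. \<forall>i\<in>{..<d}. dist (e (r n) i) (l i) < \<epsilon>"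
    by blast
  have lim: "(\<lambda>n. e (r n) i) \<longlonglongrightarrow> l i" if "i < d" for i
  proof (rule tendstoI)
    fix \<epsilon> :: real assume "\<epsilon> > 0"
    from l[OF this] show "\<forall>\<^sub>F n in sequentially. dist (e (r n) i) (l i) < \<epsilon>"
      by eventually_elim (use that in auto)
  qed
  have orth: "l i \<bullet> l j = (if i = j then 1 else 0)" if "i < d" "j < d" for i j
  proof -
    have "(\<lambda>n. e (r n) i \<bullet> e (r n) j) \<longlonglongrightarrow> l i \<bullet> l j"
      by (intro tendsto_inner lim that)
    then have "(\<lambda>n. if i = j then 1 else (0::real)) \<longlonglongrightarrow> l i \<bullet> l j"
      using e(2) that by simp
    then show ?thesis by (simp add: LIMSEQ_const_iff)
  qed
  have inj: "inj_on l {..<d}"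
    by (rule inj_onI) (metis lessThan_iff orth zero_neq_one)
  define W where "W = span (l ` {..<d})"
  have "independent (l ` {..<d})"
  proof (rule pairwise_orthogonal_independent)
    show "pairwise orthogonal (l ` {..<d})"
      unfolding pairwise_def orthogonal_def using orth by auto
    show "0 \<notin> l ` {..<d}"
      using orth by (metis imageE inner_zero_left lessThan_iff zero_neq_one)
  qed
  then have "dim W = d"
    using inj by (simp add: W_def dim_eq_card_independent card_image)
  moreover have "\<exists>x. x \<longlonglongrightarrow> \<theta> \<and> (\<forall>n. x n \<in> V (r n))" if "\<theta> \<in> W" for \<theta>
  proof -
    have "\<theta> \<in> range (\<lambda>u. \<Sum>v\<in>l ` {..<d}. u v *\<^sub>R v)"
      using that by (simp add: W_def span_finite)
    then obtain u where "\<theta> = (\<Sum>v\<in>l ` {..<d}. u v *\<^sub>R v)"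
      by (rule rangeE)
    then have \<theta>: "\<theta> = (\<Sum>i<d. u (l i) *\<^sub>R l i)"
      using inj by (simp add: sum.reindex)
    show ?thesis
    proof (intro exI[of _ "\<lambda>n. \<Sum>i<d. u (l i) *\<^sub>R e (r n) i"] conjI allI)
      show "(\<lambda>n. \<Sum>i<d. u (l i) *\<^sub>R e (r n) i) \<longlonglongrightarrow> \<theta>"
        unfolding \<theta> by (intro tendsto_intros lim) auto
      show "(\<Sum>i<d. u (l i) *\<^sub>R e (r n) i) \<in> V (r n)" for n
        using e(1)[of "r n"] by (intro subspace_sum subspace_scale V) auto
    qed
  qed
  ultimately show ?thesis
    using that[OF r, of W] by (simp add: W_def)
qed

text \<open>A diagonal argument: a limit subspace for the thresholds \<open>n + 1\<close> inherits
  approximation at every threshold. This removes the dependence of the subspace on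
  \<open>C\<close>.\<close>

lemma approximates_limit:
  fixes Q :: "'a::euclidean_space set"
  assumes "\<And>C. C > 0 \<Longrightarrow> \<exists>V. subspace V \<and> dim V = d \<and> approximates Q C V"
  obtains W where "subspace W" "dim W = d" "\<And>C. approximates Q C W"
proof -
  obtain V where V: "\<And>n. subspace (V n)" "\<And>n. dim (V n) = d" "\<And>n. approximates Q (real (Suc n)) (V n)"
    using assms[of "real (Suc n)" for n] by (metis of_nat_0_less_iff zero_less_Suc)
  obtain W r where W: "strict_mono (r :: nat \<Rightarrow> nat)" "subspace W" "dim W = d"
    "\<And>\<theta>. \<theta> \<in> W \<Longrightarrow> \<exists>x. x \<longlonglongrightarrow> \<theta> \<and> (\<forall>n. x n \<in> V (r n))"
    using subspaces_subsequence_limit[of V d, OF V(1) V(2)] by metis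
  have "approximates Q C W" for C
    unfolding approximates_def
  proof (intro ballI impI allI)
    fix \<theta> and \<eta> :: real
    assume *: "\<theta> \<in> W" "norm \<theta> = 1" "\<eta> > 0"
    obtain x where x: "x \<longlonglongrightarrow> \<theta>" "\<And>n. x n \<in> V (r n)" using W(4)[OF *(1)] by blast
    have "\<theta> \<noteq> 0" using *(2) by auto
    then have "(\<lambda>n. sgn (x n)) \<longlonglongrightarrow> sgn \<theta>" by (intro tendsto_sgn x)
    also have "sgn \<theta> = \<theta>" using *(2) by (simp add: sgn_div_norm)
    finally have "\<forall>\<^sub>F n in sequentially. norm (sgn (x n) - \<theta>) < \<eta> / 2"
      using *(3) by (auto dest!: tendstoD[of _ _ _ "\<eta> / 2"] simp: dist_norm)
    moreover have "\<forall>\<^sub>F n in sequentially. x n \<noteq> 0"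
      using x(1) \<open>\<theta> \<noteq> 0\<close> tendsto_imp_eventually_ne by blast
    moreover have "\<forall>\<^sub>F n in sequentially. n \<ge> nat \<lceil>C\<rceil>"
      by (rule eventually_ge_at_top)
    ultimately have "\<forall>\<^sub>F n in sequentially. norm (sgn (x n) - \<theta>) < \<eta> / 2 \<and> x n \<noteq> 0 \<and> n \<ge> nat \<lceil>C\<rceil>"
      by eventually_elim auto
    then obtain n where n: "norm (sgn (x n) - \<theta>) < \<eta> / 2" "x n \<noteq> 0" "n \<ge> nat \<lceil>C\<rceil>"
      using eventually_happens'[OF sequentially_bot] by blast
    have "sgn (x n) \<in> V (r n)" "norm (sgn (x n)) = 1"
      using x(2)[of n] n(2) V(1) by (auto simp: sgn_div_norm subspace_scale)
    then obtain q where q: "q \<in> Q" "norm q \<ge> real (Suc (r n))"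
        "norm (sgn q - sgn (x n)) < \<eta> / 2 \<or> norm (sgn q + sgn (x n)) < \<eta> / 2"
      using V(3)[of "r n", unfolded approximates_def, rule_format, of "sgn (x n)" "\<eta> / 2"] *(3) by auto
    \<comment> \<open>Passing to the subsequence only raises the threshold, so \<open>q\<close> is
      still long enough.\<close>
    have "n \<le> r n" using W(1) by (rule seq_suble)
    then have "C \<le> norm q" using q(2) n(3) by linarith
    moreover have "norm (sgn q - \<theta>) < \<eta> \<or> norm (sgn q + \<theta>) < \<eta>"
      using q(3)
    proof
      assume "norm (sgn q - sgn (x n)) < \<eta> / 2"
      then show ?thesis
        using n(1) norm_triangle_ineq[of "sgn q - sgn (x n)" "sgn (x n) - \<theta>"] by simp
    next
      assume "norm (sgn q + sgn (x n)) < \<eta> / 2"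
      then show ?thesis
        using n(1) norm_triangle_ineq4[of "sgn q + sgn (x n)" "sgn (x n) - \<theta>"] by simp
    qed
    ultimately show "\<exists>q\<in>Q. norm q \<ge> C \<and> (norm (sgn q - \<theta>) < \<eta> \<or> norm (sgn q + \<theta>) < \<eta>)"
      using q(1) by blast
  qed
  then show ?thesis using that W by blast
qed

lemma sgn_in_subspace_iff:
  fixes x :: "'a::real_normed_vector"
  assumes "subspace U"
  shows "sgn x \<in> U \<longleftrightarrow> x \<in> U"
proof
  assume "sgn x \<in> U"
  then have "norm x *\<^sub>R sgn x \<in> U" using assms by (rule subspace_scale[rotated])
  then show "x \<in> U" by (cases "x = 0") (simp_all add: sgn_div_norm)
next
  assume "x \<in> U"
  then show "sgn x \<in> U" using assms by (simp add: sgn_div_norm subspace_scale)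
qed

text \<open>The directions of \<open>V\<close> outside \<open>U\<close> are dense among the
  directions of \<open>V\<close>. Since \<open>U\<close> is closed, vectors pointing nearly in such
  a direction are not in \<open>U\<close>.\<close>

lemma approximates_Diff_subspace:
  assumes Q: "approximates Q C V" and V: "subspace V" and U: "subspace U" and "\<not> V \<subseteq> U"
  shows "approximates (Q - U) C V"
  unfolding approximates_def
proof (intro ballI impI allI)
  fix \<theta> and \<eta> :: real
  assume *: "\<theta> \<in> V" "norm \<theta> = 1" "\<eta> > 0"
  obtain v where v: "v \<in> V" "v \<notin> U" using assms(4) by blast
  have "\<exists>\<theta>'\<in>V. \<theta>' \<notin> U \<and> norm \<theta>' = 1 \<and> norm (\<theta>' - \<theta>) < \<eta> / 2"
  proof (cases "\<theta> \<in> U")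
    case False
    then show ?thesis using * by (intro bexI[of _ \<theta>]) auto
  next
    case True
    \<comment> \<open>Tilting \<open>\<theta>\<close> towards a vector of \<open>V\<close> outside
      \<open>U\<close> leaves \<open>U\<close> for every positive \<open>t\<close>.\<close>
    define w where "w t = \<theta> + t *\<^sub>R v" for t
    have "(w \<longlongrightarrow> \<theta> + 0 *\<^sub>R v) (at_right 0)"
      unfolding w_def by (intro tendsto_add tendsto_scaleR tendsto_const tendsto_ident_at)
    then have "((\<lambda>t. sgn (w t)) \<longlongrightarrow> sgn \<theta>) (at_right 0)"
      using *(2) by (intro tendsto_sgn) auto
    also have "sgn \<theta> = \<theta>" using *(2) by (simp add: sgn_div_norm)
    finally have "\<forall>\<^sub>F t in at_right 0. norm (sgn (w t) - \<theta>) < \<eta> / 2"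
      using *(3) by (auto dest!: tendstoD[of _ _ _ "\<eta> / 2"] simp: dist_norm)
    moreover have "\<forall>\<^sub>F t in at_right (0::real). t > 0"
      by (simp add: eventually_at_right_less)
    ultimately have "\<forall>\<^sub>F t in at_right 0. norm (sgn (w t) - \<theta>) < \<eta> / 2 \<and> t > 0"
      by eventually_elim auto
    then obtain t where t: "norm (sgn (w t) - \<theta>) < \<eta> / 2" "t > 0"
      using eventually_happens'[of "at_right (0::real)"] by (auto simp: trivial_limit_at_right_real)
    have "w t \<notin> U"
    proof
      assume "w t \<in> U"
      then have "(1 / t) *\<^sub>R (w t - \<theta>) \<in> U"
        using True U by (intro subspace_scale subspace_diff)
      then show False using v t by (simp add: w_def)
    qed
    moreover from this have "w t \<noteq> 0" using U subspace_0 by metis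
    moreover have "w t \<in> V"
      unfolding w_def using * v V by (intro subspace_add subspace_scale)
    ultimately have "sgn (w t) \<in> V" "sgn (w t) \<notin> U" "norm (sgn (w t)) = 1"
      using U V by (simp_all add: norm_sgn sgn_in_subspace_iff)
    then show ?thesis using t(1) by blast
  qed
  then obtain \<theta>' where \<theta>': "\<theta>' \<in> V" "\<theta>' \<notin> U" "norm \<theta>' = 1" "norm (\<theta>' - \<theta>) < \<eta> / 2" by blast
  have "open (- U)" using closed_subspace[OF U] by blast
  then obtain \<delta> where \<delta>: "\<delta> > 0" "ball \<theta>' \<delta> \<subseteq> - U"
    using \<theta>'(2) open_contains_ball by blast
  \<comment> \<open>The bound \<delta> keeps the direction of \<open>q\<close> off \<open>U\<close>;
    the other half of \<eta> was spent in moving from \<open>\<theta>\<close> to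
    \<open>\<theta>'\<close>.\<close>
  obtain q where q: "q \<in> Q" "norm q \<ge> C"
      "norm (sgn q - \<theta>') < min \<delta> (\<eta> / 2) \<or> norm (sgn q + \<theta>') < min \<delta> (\<eta> / 2)"
    using Q[unfolded approximates_def, rule_format, OF \<theta>'(1,3), of "min \<delta> (\<eta> / 2)"] \<delta>(1) *(3) by auto
  have "q \<notin> U"
  proof
    assume "q \<in> U"
    then have "sgn q \<in> U" "- sgn q \<in> U"
      using U by (simp_all add: sgn_in_subspace_iff subspace_neg)
    then have "sgn q \<notin> ball \<theta>' \<delta>" "- sgn q \<notin> ball \<theta>' \<delta>" using \<delta>(2) by auto
    moreover have "dist \<theta>' (- sgn q) = norm (sgn q + \<theta>')"
      by (metis add.commute diff_minus_eq_add dist_norm)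
    ultimately show False using q(3) by (auto simp: dist_norm norm_minus_commute)
  qed
  moreover have "norm (sgn q - \<theta>) < \<eta> \<or> norm (sgn q + \<theta>) < \<eta>"
    using q(3)
  proof
    assume "norm (sgn q - \<theta>') < min \<delta> (\<eta> / 2)"
    then show ?thesis
      using \<theta>'(4) norm_triangle_ineq[of "sgn q - \<theta>'" "\<theta>' - \<theta>"] by simp
  next
    assume "norm (sgn q + \<theta>') < min \<delta> (\<eta> / 2)"
    then show ?thesis
      using \<theta>'(4) norm_triangle_ineq4[of "sgn q + \<theta>'" "\<theta>' - \<theta>"] by simp
  qed
  ultimately show "\<exists>q\<in>Q - U. norm q \<ge> C \<and> (norm (sgn q - \<theta>) < \<eta> \<or> norm (sgn q + \<theta>) < \<eta>)"
    using q by blast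
qed

text \<open>With two limit subspaces \<open>V\<close> and \<open>W\<close>, a vector outside their
  intersection is missed by one of them, and neither is lost in the removal because distinct
  subspaces of equal dimension are not nested. With a single one, all of \<open>V\<close> is removed
  and compactness has to recover it.\<close>

lemma exists_transverse_subset:
  fixes Q :: "'a::euclidean_space set"
  assumes two: "\<And>C. C > 0 \<Longrightarrow> \<exists>V\<^sub>1 V\<^sub>2. subspace V\<^sub>1 \<and> dim V\<^sub>1 = d \<and> approximates Q C V\<^sub>1 \<and>
    subspace V\<^sub>2 \<and> dim V\<^sub>2 = d \<and> approximates Q C V\<^sub>2 \<and> V\<^sub>1 \<noteq> V\<^sub>2"
  obtains Q' where "Q' \<subseteq> Q" "\<exists>V. subspace V \<and> dim V = d \<and> (\<forall>C. approximates Q' C V)"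
    "\<forall>q\<in>Q'. \<exists>V. subspace V \<and> dim V = d \<and> (\<forall>C. approximates Q' C V) \<and> q \<notin> V"
proof -
  have ns: "\<not> V \<subseteq> W" if "subspace V" "subspace W" "dim V = d" "dim W = d" "V \<noteq> W" for V W :: "'a set"
    using that subspace_dim_equal[of V W] by auto
  obtain V where V: "subspace V" "dim V = d" "\<And>C. approximates Q C V"
    using approximates_limit[of d Q] two by blast
  show ?thesis
  proof (cases "\<exists>W. subspace W \<and> dim W = d \<and> (\<forall>C. approximates Q C W) \<and> W \<noteq> V")
    case True
    then obtain W where W: "subspace W" "dim W = d" "\<And>C. approximates Q C W" "W \<noteq> V" by blast
    have sub: "subspace (V \<inter> W)" using V W by (simp add: subspace_inter)
    have "\<not> V \<subseteq> V \<inter> W" "\<not> W \<subseteq> V \<inter> W"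
      using ns[of V W] ns[of W V] V W by auto
    then have *: "approximates (Q - V \<inter> W) C V" "approximates (Q - V \<inter> W) C W" for C
      using approximates_Diff_subspace[OF _ _ sub] V W by blast+
    show ?thesis
    proof (rule that[of "Q - V \<inter> W"])
      show "\<forall>q\<in>Q - V \<inter> W. \<exists>V'. subspace V' \<and> dim V' = d \<and>
          (\<forall>C. approximates (Q - V \<inter> W) C V') \<and> q \<notin> V'"
        using * V(1,2) W(1,2) by blast
    qed (use * V(1,2) in auto)
  next
    case False
    \<comment> \<open>At each threshold one of the two given subspaces differs from
      \<open>V\<close>, so it survives the removal of \<open>V\<close>; which one it is may depend
      on \<open>C\<close>.\<close>
    have "\<exists>W. subspace W \<and> dim W = d \<and> approximates (Q - V) C W" if "C > 0" for C
    proof -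
      obtain W where "subspace W" "dim W = d" "approximates Q C W" "W \<noteq> V"
        using two[OF \<open>C > 0\<close>] by metis
      then show ?thesis
        using approximates_Diff_subspace[of Q C W V] V ns[of W V] by blast
    qed
    then obtain W where W: "subspace W" "dim W = d" "\<And>C. approximates (Q - V) C W"
      using approximates_limit[of d "Q - V"] by blast
    \<comment> \<open>A limit subspace of \<open>Q - V\<close> is one of \<open>Q\<close>, and
      \<open>V\<close> is the only one.\<close>
    then have "W = V"
      using False approximates_mono[of "Q - V" _ W Q] by blast
    show ?thesis
      by (rule that[of "Q - V"]) (use W \<open>W = V\<close> in auto)
  qed
qed

section \<open>Logarithmic density at large scales\<close>

text \<open>Once the ratios of consecutive terms are below \<open>1 + \<delta>\<close>, the first
  term to exceed a large bound exceeds it by at most this factor. Thus some point of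
  \<open>P\<close> has nearly the length \<open>r * c\<close> and nearly the direction
  \<open>\<phi>\<close>.\<close>

lemma log_dense_along_scaled:
  assumes P: "log_dense_along P \<phi>" and \<phi>: "norm \<phi> = 1" and c: "c > 0" and \<eta>: "\<eta> > 0"
  shows "\<exists>C. \<forall>r\<ge>C. \<exists>p\<in>P. norm (p /\<^sub>R r - c *\<^sub>R \<phi>) < \<eta>"
proof -
  \<comment> \<open>The radial and the angular error are each at most \<open>c * \<delta>\<close>,
    half of \<eta>.\<close>
  define \<delta> where "\<delta> = \<eta> / (2 * c)"
  have "\<delta> > 0" using c \<eta> by (simp add: \<delta>_def)
  obtain s :: "nat \<Rightarrow> real" where s: "range s \<subseteq> norms_along P \<phi> \<delta>" "\<not> bounded (range s)"
      "(\<lambda>i. s (Suc i) / s i) \<longlonglongrightarrow> 1"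
    using P \<open>\<delta> > 0\<close> unfolding log_dense_along_def by blast
  have rep: "\<exists>p\<in>P. s i = norm p \<and> p \<noteq> 0 \<and> norm (sgn p - \<phi>) < \<delta>" for i
    using s(1) by (auto simp: norms_along_def)
  have pos: "s i > 0" for i
    using rep[of i] by auto
  have "\<forall>\<^sub>F i in sequentially. s (Suc i) / s i < 1 + \<delta>"
    using order_tendstoD(2)[OF s(3)] \<open>\<delta> > 0\<close> by simp
  then obtain N where N: "\<And>i. i \<ge> N \<Longrightarrow> s (Suc i) / s i < 1 + \<delta>"
    by (auto simp: eventually_sequentially)
  define M where "M = Max (s ` {..N})"
  have M: "s i \<le> M" if "i \<le> N" for i
    unfolding M_def using that by (intro Max_ge) auto
  have "M > 0" using M[of 0] pos[of 0] by simp
  have hit: "\<exists>i. R < s i \<and> s i \<le> (1 + \<delta>) * R" if "R \<ge> M" for R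
  proof -
    have "\<exists>i. s i > R"
    proof (rule ccontr)
      assume "\<nexists>i. s i > R"
      then have "\<forall>x\<in>range s. norm x \<le> R" using pos by (auto simp: not_less abs_of_pos)
      then show False using s(2) by (auto simp: bounded_iff)
    qed
    define j where "j = (LEAST i. s i > R)"
    have j: "s j > R" unfolding j_def using \<open>\<exists>i. s i > R\<close> by (rule LeastI_ex)
    \<comment> \<open>The terms up to \<open>N\<close> are at most \<open>M\<close>, so the
      predecessor of \<open>j\<close> is already in the range where the ratios are
      controlled.\<close>
    have "j > N" using j M[of j] that by force
    then obtain i where i: "j = Suc i" "i \<ge> N" by (cases j) auto
    have "s i \<le> R" using not_less_Least[of i "\<lambda>i. s i > R"] i by (auto simp: j_def)
    have "s j < (1 + \<delta>) * s i" using N[OF i(2)] pos[of i] i by (simp add: divide_less_eq)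
    also have "\<dots> \<le> (1 + \<delta>) * R" using \<open>s i \<le> R\<close> \<open>\<delta> > 0\<close> by simp
    finally show ?thesis using j by (intro exI[of _ j]) auto
  qed
  have "\<exists>p\<in>P. norm (p /\<^sub>R r - c *\<^sub>R \<phi>) < \<eta>" if r: "r \<ge> M / c" for r
  proof -
    have "r * c \<ge> M" using r c by (simp add: divide_le_eq)
    have "r > 0" using r c \<open>M > 0\<close> by (smt (verit) divide_pos_pos)
    obtain i where i: "r * c < s i" "s i \<le> (1 + \<delta>) * (r * c)"
      using hit[OF \<open>r * c \<ge> M\<close>] by blast
    obtain p where p: "p \<in> P" "s i = norm p" "p \<noteq> 0" "norm (sgn p - \<phi>) < \<delta>" using rep by blast
    have "p /\<^sub>R r - c *\<^sub>R \<phi> = (norm p / r - c) *\<^sub>R sgn p + c *\<^sub>R (sgn p - \<phi>)"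
      using p(3) by (simp add: sgn_div_norm algebra_simps divide_inverse)
    also have "norm \<dots> \<le> norm ((norm p / r - c) *\<^sub>R sgn p) + norm (c *\<^sub>R (sgn p - \<phi>))"
      by (rule norm_triangle_ineq)
    also have "\<dots> = \<bar>norm p / r - c\<bar> + c * norm (sgn p - \<phi>)"
      using p(3) c by (simp add: norm_sgn)
    also have "\<bar>norm p / r - c\<bar> \<le> c * \<delta>"
    proof -
      have "norm p / r > c" "norm p / r \<le> (1 + \<delta>) * c"
        using i p(2) \<open>r > 0\<close> by (simp_all add: field_simps)
      then show ?thesis by (simp add: algebra_simps)
    qed
    also have "c * \<delta> + c * norm (sgn p - \<phi>) < c * \<delta> + c * \<delta>"
      using p(4) c by simp
    also have "\<dots> = \<eta>" using c by (simp add: \<delta>_def)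
    finally show ?thesis using p(1) by fastforce
  qed
  then show ?thesis by blast
qed

text \<open>For \<open>h = 0\<close> there is no direction to use, but a fixed point of
  \<open>P\<close> divided by a large \<open>r\<close> tends to 0.\<close>

lemma log_dense_in_scaled:
  assumes P: "log_dense_in P H" "P \<noteq> {}" and H: "subspace H" "h \<in> H" and \<eta>: "\<eta> > 0"
  shows "\<exists>C. \<forall>r\<ge>C. \<exists>p\<in>P. norm (p /\<^sub>R r - h) < \<eta>"
proof (cases "h = 0")
  case True
  obtain p where p: "p \<in> P" using P(2) by blast
  have "norm (p /\<^sub>R r - h) < \<eta>" if r: "r \<ge> norm p / \<eta> + 1" for r
  proof -
    have "r > 0" using r \<eta> by (smt (verit) divide_nonneg_pos norm_ge_zero)
    have "norm p / \<eta> < r" using r by simp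
    then have "norm p < r * \<eta>" using \<eta> by (simp add: divide_less_eq)
    then show ?thesis using True \<open>r > 0\<close> by (simp add: divide_simps mult.commute)
  qed
  then show ?thesis using p by blast
next
  case False
  have "log_dense_along P (sgn h)"
    using P(1) H False by (auto simp: log_dense_in_def norm_sgn sgn_div_norm subspace_scale)
  from log_dense_along_scaled[OF this _ _ \<eta>, of "norm h"] show ?thesis
    using False by (simp add: norm_sgn sgn_div_norm)
qed

section \<open>Linear algebra of matrices\<close>

text \<open>If \<open>A\<close> is injective on \<open>V\<close>, the dimensions of the image and of
  \<open>H\<close> add up to more than that of the whole space, so they share a nonzero vector.
  Otherwise a kernel vector in \<open>V\<close> will do.\<close>

lemma subspace_meets_preimage:
  fixes A :: "real^'n^'m"
  assumes "subspace V" "dim V = k + 1" "subspace H" "dim H = CARD('m) - k" "k \<le> CARD('m)"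
  obtains \<theta> where "\<theta> \<in> V" "norm \<theta> = 1" "A *v \<theta> \<in> H"
proof -
  have lin: "linear ((*v) A)" by simp
  have "\<exists>x\<in>V. x \<noteq> 0 \<and> A *v x \<in> H"
  proof (cases "inj_on ((*v) A) V")
    case True
    have "dim ((*v) A ` V) = k + 1"
      using dim_image_eq[OF lin] True assms(1,2) by (metis span_eq_iff)
    moreover have sub: "subspace ((*v) A ` V)" using lin assms(1) by (rule linear_subspace_image)
    moreover have "dim {x + y |x y. x \<in> (*v) A ` V \<and> y \<in> H} \<le> CARD('m)"
      by (rule dim_subset_UNIV_cart)
    ultimately have "dim ((*v) A ` V \<inter> H) \<noteq> 0"
      using dim_sums_Int[OF sub assms(3)] assms(4,5) by linarith
    then obtain y where "y \<in> (*v) A ` V" "y \<in> H" "y \<noteq> 0"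
      by (metis Int_iff dim_eq_0 singletonI subsetI)
    then show ?thesis by (metis imageE matrix_vector_mult_0_right)
  next
    case False
    then obtain x y where "x \<in> V" "y \<in> V" "x \<noteq> y" "A *v x = A *v y" by (auto simp: inj_on_def)
    then show ?thesis
      using assms(1,3) by (intro bexI[of _ "x - y"])
        (auto simp: matrix_vector_mult_diff_distrib subspace_0 subspace_diff)
  qed
  then obtain x where x: "x \<in> V" "x \<noteq> 0" "A *v x \<in> H" by blast
  show ?thesis
    by (rule that[of "sgn x"])
      (use x assms(1,3) in \<open>auto simp: norm_sgn sgn_div_norm subspace_scale matrix_vector_mult_scaleR\<close>)
qed

definition outer :: "real^'m \<Rightarrow> real^'n \<Rightarrow> real^'n^'m" where
  "outer v w = (\<chi> i j. v $ i * w $ j)"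

lemma outer_mult_vector: "outer v w *v x = (w \<bullet> x) *\<^sub>R v"
  by (simp add: outer_def matrix_vector_mult_def inner_vec_def vec_eq_iff sum_distrib_left sum_distrib_right mult_ac)

lemma norm_outer: "norm (outer v w) = norm v * norm w"
proof -
  have "outer v w = (\<chi> i. v $ i *\<^sub>R w)" by (simp add: outer_def vec_eq_iff)
  then show ?thesis
    by (simp add: norm_vec_def[of "\<chi> i. v $ i *\<^sub>R w"] norm_vec_def[of v] L2_set_left_distrib[symmetric])
qed

text \<open>The norm of the type is the Frobenius norm, so this is Cauchy-Schwarz applied row by
  row.\<close>

lemma norm_matrix_vector_mult_le:
  fixes A :: "real^'n^'m"
  shows "norm (A *v x) \<le> norm A * norm x"
proof -
  have "norm (A *v x) = L2_set (\<lambda>i. \<bar>(A $ i) \<bullet> x\<bar>) UNIV"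
    by (simp add: norm_vec_def matrix_vector_mul_component)
  also have "\<dots> \<le> L2_set (\<lambda>i. norm (A $ i) * norm x) UNIV"
    by (intro L2_set_mono Cauchy_Schwarz_ineq2) auto
  also have "\<dots> = norm A * norm x"
    by (simp add: norm_vec_def[of A] L2_set_left_distrib)
  finally show ?thesis .
qed

subsection \<open>Intersections of fibres\<close>

text \<open>
  Here \<open>A'\<close> witnesses that the fibre of \<open>(p', q')\<close> meets that of \<open>(p, q)\<close> inside \<open>W\<close>, and \<open>X\<close> that it
  passes near \<open>A\<close>. This is stronger than total density: the open set filled by the fibres contains
  the given point \<open>A\<^sub>0\<close>, and \<open>q'\<close> can be taken arbitrarily long.
\<close>

definition transversal :: "(real^'m) set \<Rightarrow> (real^'n) set \<Rightarrow> bool" where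
  "transversal P Q \<longleftrightarrow> (\<forall>p\<in>P. \<forall>q\<in>Q. \<forall>W A\<^sub>0 C. open W \<longrightarrow> A\<^sub>0 \<in> W \<longrightarrow> A\<^sub>0 *v q = p \<longrightarrow>
     (\<exists>O'. open O' \<and> A\<^sub>0 \<in> O' \<and> (\<forall>A\<in>O'. \<forall>\<epsilon>>0. \<exists>p'\<in>P. \<exists>q'\<in>Q. \<exists>A' X.
        C \<le> norm q' \<and> A' \<in> W \<and> A' *v q = p \<and> A' *v q' = p' \<and> X *v q' = p' \<and> dist X A < \<epsilon>)))"

lemma transversalD:
  assumes "transversal P Q" "p \<in> P" "q \<in> Q" "open W" "A\<^sub>0 \<in> W" "A\<^sub>0 *v q = p"
  obtains O' where "open O'" "A\<^sub>0 \<in> O'" "\<forall>A\<in>O'. \<forall>\<epsilon>>0. \<exists>p'\<in>P. \<exists>q'\<in>Q. \<exists>A' X.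
        C \<le> norm q' \<and> A' \<in> W \<and> A' *v q = p \<and> A' *v q' = p' \<and> X *v q' = p' \<and> dist X A < \<epsilon>"
proof -
  have "\<exists>O'. open O' \<and> A\<^sub>0 \<in> O' \<and> (\<forall>A\<in>O'. \<forall>\<epsilon>>0. \<exists>p'\<in>P. \<exists>q'\<in>Q. \<exists>A' X.
        C \<le> norm q' \<and> A' \<in> W \<and> A' *v q = p \<and> A' *v q' = p' \<and> X *v q' = p' \<and> dist X A < \<epsilon>)"
    using assms unfolding transversal_def by simp
  then obtain O' where O': "open O'" "A\<^sub>0 \<in> O'" "\<forall>A\<in>O'. \<forall>\<epsilon>>0. \<exists>p'\<in>P. \<exists>q'\<in>Q. \<exists>A' X.
        C \<le> norm q' \<and> A' \<in> W \<and> A' *v q = p \<and> A' *v q' = p' \<and> X *v q' = p' \<and> dist X A < \<epsilon>"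
    by (elim exE conjE)
  show ?thesis
    by (rule that[OF O'])
qed

text \<open>Choose \<open>\<theta>\<close> in \<open>V\<close> with \<open>A *v \<theta>\<close> in
  \<open>H\<close>, then a long \<open>q\<close> close to the line of \<open>\<theta>\<close>, and
  finally \<open>p\<close> by logarithmic density at the scale \<open>norm q\<close>.\<close>

lemma fibre_near_matrix:
  fixes A :: "real^'n^'m" and P H :: "(real^'m) set"
  assumes P: "log_dense_in P H" "P \<noteq> {}" and H: "subspace H" "dim H = CARD('m) - k" "k \<le> CARD('m)"
    and V: "subspace V" "dim V = k + 1" "\<And>C. approximates Q C V" and \<eta>: "\<eta> > 0"
  obtains \<theta> p q where "\<theta> \<in> V" "norm \<theta> = 1" "p \<in> P" "q \<in> Q" "C \<le> norm q" "q \<noteq> 0"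
    "norm (sgn q - \<theta>) < \<eta> \<or> norm (sgn q + \<theta>) < \<eta>" "norm (p - A *v q) \<le> \<eta> * norm q"
proof -
  obtain \<theta> where \<theta>: "\<theta> \<in> V" "norm \<theta> = 1" "A *v \<theta> \<in> H"
    using subspace_meets_preimage[OF V(1,2) H] by metis
  \<comment> \<open>One \<delta> is spent on the choice of \<open>p\<close>, and
    \<open>norm A * \<delta>\<close> on replacing the limit direction by
    \<open>sgn q\<close>.\<close>
  define \<delta> where "\<delta> = \<eta> / (1 + norm A)"
  have "1 + norm A > 0" by (simp add: add_pos_nonneg)
  then have "\<delta> > 0" "\<delta> * (1 + norm A) = \<eta>"
    using \<eta> by (simp_all add: \<delta>_def)
  then have \<delta>: "\<delta> > 0" "\<delta> + norm A * \<delta> = \<eta>" "\<delta> \<le> \<eta>"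
    by (auto simp: algebra_simps)
  have "- (A *v \<theta>) \<in> H" using \<theta>(3) H(1) by (rule subspace_neg[rotated])
  obtain C1 where C1: "\<And>r. r \<ge> C1 \<Longrightarrow> \<exists>p\<in>P. norm (p /\<^sub>R r - A *v \<theta>) < \<delta>"
    using log_dense_in_scaled[OF P H(1) \<theta>(3) \<delta>(1)] by blast
  obtain C2 where C2: "\<And>r. r \<ge> C2 \<Longrightarrow> \<exists>p\<in>P. norm (p /\<^sub>R r - - (A *v \<theta>)) < \<delta>"
    using log_dense_in_scaled[OF P H(1) \<open>- (A *v \<theta>) \<in> H\<close> \<delta>(1)] by blast
  \<comment> \<open>Whether \<open>q\<close> points along \<open>\<theta>\<close> or
    \<open>- \<theta>\<close> is known only after its choice, so the thresholds for both signs are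
    met in advance; the 1 makes \<open>q\<close> nonzero.\<close>
  define M where "M = max (max C 1) (max C1 C2)"
  obtain q where q: "q \<in> Q" "norm q \<ge> M" "norm (sgn q - \<theta>) < \<delta> \<or> norm (sgn q + \<theta>) < \<delta>"
    using V(3)[of M, unfolded approximates_def, rule_format, OF \<theta>(1,2) \<delta>(1)] by blast
  have qM: "norm q \<ge> C" "norm q \<ge> 1" "norm q \<ge> C1" "norm q \<ge> C2" using q(2) by (auto simp: M_def)
  then have "q \<noteq> 0" by auto
  have close: "norm (p - A *v q) \<le> \<eta> * norm q"
    if p: "norm (p /\<^sub>R norm q - A *v x) < \<delta>" and x: "norm (sgn q - x) < \<delta>" for p x
  proof -
    have "norm (p /\<^sub>R norm q - A *v sgn q) \<le> norm (p /\<^sub>R norm q - A *v x) + norm (A *v x - A *v sgn q)"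
      using norm_triangle_ineq[of "p /\<^sub>R norm q - A *v x" "A *v x - A *v sgn q"] by simp
    also have "norm (A *v x - A *v sgn q) \<le> norm A * norm (x - sgn q)"
      unfolding matrix_vector_mult_diff_distrib[symmetric] by (rule norm_matrix_vector_mult_le)
    also have "norm A * norm (x - sgn q) \<le> norm A * \<delta>"
      using x by (intro mult_left_mono) (auto simp: norm_minus_commute)
    finally have "norm (p /\<^sub>R norm q - A *v sgn q) \<le> \<eta>" using p \<delta>(2) by linarith
    moreover have "p - A *v q = norm q *\<^sub>R (p /\<^sub>R norm q - A *v sgn q)"
      using \<open>q \<noteq> 0\<close> by (simp add: sgn_div_norm scaleR_diff_right matrix_vector_mult_scaleR)
    ultimately show ?thesis by (simp add: mult.commute[of \<eta>] mult_left_mono)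
  qed
  have "\<exists>p\<in>P. norm (p - A *v q) \<le> \<eta> * norm q"
    using q(3)
  proof
    assume "norm (sgn q - \<theta>) < \<delta>"
    then show ?thesis using C1[OF qM(3)] close by blast
  next
    assume *: "norm (sgn q + \<theta>) < \<delta>"
    obtain p where "p \<in> P" "norm (p /\<^sub>R norm q - - (A *v \<theta>)) < \<delta>" using C2[OF qM(4)] by blast
    moreover have "- (A *v \<theta>) = A *v (- \<theta>)"
      using matrix_vector_mult_scaleR[of A "-1" \<theta>] by simp
    ultimately show ?thesis using * by (intro bexI[of _ p] close[of _ "- \<theta>"]) simp_all
  qed
  then obtain p where "p \<in> P" "norm (p - A *v q) \<le> \<eta> * norm q" by blast
  then show ?thesis
    using that[OF \<theta>(1,2) _ q(1) qM(1) \<open>q \<noteq> 0\<close>] q(3) \<delta>(3) by force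
qed

text \<open>A rank-one correction that acts only along \<open>w\<close>. Taking \<open>w = q\<close>
  gives a nearby point of one fibre; taking \<open>w\<close> orthogonal to a second vector preserves
  the equation already satisfied there.\<close>

lemma fibre_correction:
  fixes A :: "real^'n^'m" and p :: "real^'m"
  assumes "w \<bullet> q = \<rho>" "\<rho> \<noteq> 0"
  defines "X \<equiv> A + outer (p - A *v q) ((1 / \<rho>) *\<^sub>R w)"
  shows "X *v q = p" "\<And>x. w \<bullet> x = 0 \<Longrightarrow> X *v x = A *v x"
    "norm (X - A) = norm (p - A *v q) * norm w / \<bar>\<rho>\<bar>"
  using assms by (simp_all add: matrix_vector_mult_add_rdistrib outer_mult_vector norm_outer)

lemma fibre_point_near:
  fixes A :: "real^'n^'m"
  assumes "norm (p - A *v q) \<le> \<eta> * norm q" "q \<noteq> 0"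
  obtains X where "X *v q = p" "norm (X - A) \<le> \<eta>"
proof -
  define X where "X = A + outer (p - A *v q) ((1 / (q \<bullet> q)) *\<^sub>R q)"
  have X: "X *v q = p" "norm (X - A) = norm (p - A *v q) * norm q / \<bar>q \<bullet> q\<bar>"
    unfolding X_def using assms(2) by (intro fibre_correction; simp)+
  have "norm (p - A *v q) * norm q / \<bar>q \<bullet> q\<bar> = norm (p - A *v q) / norm q"
    using assms(2) by (simp add: dot_square_norm power2_eq_square)
  also have "\<dots> \<le> \<eta>" using assms by (simp add: divide_le_eq)
  finally show ?thesis using that X by simp
qed

text \<open>The component of \<open>x\<close> orthogonal to \<open>q\<close>. For
  \<open>q = 0\<close> division by zero makes it \<open>x\<close> itself.\<close>

definition reject :: "'a::real_inner \<Rightarrow> 'a \<Rightarrow> 'a" where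
  "reject q x = x - ((x \<bullet> q) / (q \<bullet> q)) *\<^sub>R q"

lemma reject_inner_left: "reject q x \<bullet> q = 0"
  by (cases "q = 0") (simp_all add: reject_def inner_diff_left)

lemma reject_inner_right: "reject q x \<bullet> x = (norm (reject q x))\<^sup>2"
proof -
  have "reject q x \<bullet> reject q x = reject q x \<bullet> x - ((x \<bullet> q) / (q \<bullet> q)) * (reject q x \<bullet> q)"
    by (simp add: reject_def[of q x] inner_diff_right inner_diff_left)
  then show ?thesis by (simp add: reject_inner_left power2_norm_eq_inner)
qed

lemma norm_reject_le: "norm (reject q x) \<le> norm x"
proof (cases "reject q x = 0")
  case False
  have "(norm (reject q x))\<^sup>2 \<le> norm (reject q x) * norm x"
    using norm_cauchy_schwarz[of "reject q x" x] by (simp add: reject_inner_right)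
  then show ?thesis using False by (simp add: power2_eq_square)
qed simp

lemma reject_diff: "reject q (x - y) = reject q x - reject q y"
  by (simp add: reject_def inner_diff_left diff_divide_distrib algebra_simps)

lemma reject_scaleR: "reject q (c *\<^sub>R x) = c *\<^sub>R reject q x"
  by (simp add: reject_def algebra_simps)

text \<open>The minimum over the compact unit sphere of \<open>V\<close> is attained. Were it 0, a
  unit vector of \<open>V\<close> would be a multiple of \<open>q\<close>, forcing \<open>q\<close>
  into \<open>V\<close>.\<close>

lemma reject_bounded_below:
  fixes q :: "'a::euclidean_space"
  assumes V: "subspace V" and q: "q \<notin> V"
  obtains c where "c > 0" "\<And>\<theta>. \<theta> \<in> V \<Longrightarrow> norm \<theta> = 1 \<Longrightarrow> c \<le> norm (reject q \<theta>)"
proof (cases "V \<inter> sphere 0 1 = {}")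
  case True
  then show ?thesis by (intro that[of 1]) auto
next
  case False
  have "compact (V \<inter> sphere 0 1)"
    using closed_subspace[OF V] by (simp add: closed_Int_compact)
  moreover have "continuous_on (V \<inter> sphere 0 1) (\<lambda>\<theta>. norm (reject q \<theta>))"
    unfolding reject_def using q V subspace_0 by (intro continuous_intros) auto
  ultimately obtain \<theta>\<^sub>0 where \<theta>\<^sub>0: "\<theta>\<^sub>0 \<in> V \<inter> sphere 0 1"
      "\<And>\<theta>. \<theta> \<in> V \<inter> sphere 0 1 \<Longrightarrow> norm (reject q \<theta>\<^sub>0) \<le> norm (reject q \<theta>)"
    using continuous_attains_inf[OF _ False] by meson
  have "reject q \<theta>\<^sub>0 \<noteq> 0"
  proof
    define c where "c = (\<theta>\<^sub>0 \<bullet> q) / (q \<bullet> q)"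
    assume "reject q \<theta>\<^sub>0 = 0"
    then have eq: "\<theta>\<^sub>0 = c *\<^sub>R q" by (simp add: reject_def c_def)
    then have "c \<noteq> 0" using \<theta>\<^sub>0(1) by auto
    then have "q = (1 / c) *\<^sub>R \<theta>\<^sub>0" using eq by simp
    then have "q \<in> V" using \<theta>\<^sub>0(1) V by (metis IntD1 subspace_scale)
    with q show False by simp
  qed
  then show ?thesis
    using \<theta>\<^sub>0(2) by (intro that[of "norm (reject q \<theta>\<^sub>0)"]) auto
qed

text \<open>Correcting \<open>A\<^sub>0\<close> along the part \<open>w\<close> of \<open>q'\<close>
  orthogonal to \<open>q\<close> reaches the new fibre without leaving the old one. The cost is the
  defect \<open>norm (p' - A\<^sub>0 *v q')\<close> over \<open>norm w\<close>, and \<open>w\<close>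
  is a definite fraction of \<open>q'\<close> because \<open>q'\<close> points almost into
  \<open>V\<close>, which misses \<open>q\<close>.\<close>

lemma transversalI:
  fixes P H :: "(real^'m) set" and Q :: "(real^'n) set"
  assumes P: "log_dense_in P H" "P \<noteq> {}" and H: "subspace H" "dim H = CARD('m) - k" "k \<le> CARD('m)"
    and Q: "\<And>q. q \<in> Q \<Longrightarrow> \<exists>V. subspace V \<and> dim V = k + 1 \<and> (\<forall>C. approximates Q C V) \<and> q \<notin> V"
  shows "transversal P Q"
  unfolding transversal_def
proof (intro ballI allI impI)
  fix p q W and A\<^sub>0 :: "real^'n^'m" and C
  assume "p \<in> P" "q \<in> Q" "open W" "A\<^sub>0 \<in> W" and A0: "A\<^sub>0 *v q = p"
  obtain V where V: "subspace V" "dim V = k + 1" "\<And>C. approximates Q C V" "q \<notin> V"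
    using Q[OF \<open>q \<in> Q\<close>] by blast
  obtain c where c: "c > 0" "\<And>\<theta>. \<theta> \<in> V \<Longrightarrow> norm \<theta> = 1 \<Longrightarrow> c \<le> norm (reject q \<theta>)"
    using reject_bounded_below[OF V(1,4)] by metis
  obtain e where e: "e > 0" "ball A\<^sub>0 e \<subseteq> W"
    using \<open>open W\<close> \<open>A\<^sub>0 \<in> W\<close> open_contains_ball by metis
  have "\<exists>p'\<in>P. \<exists>q'\<in>Q. \<exists>A' X. C \<le> norm q' \<and> A' \<in> W \<and> A' *v q = p \<and> A' *v q' = p' \<and>
      X *v q' = p' \<and> dist X A < \<epsilon>" if A: "A \<in> ball A\<^sub>0 (e * c / 4)" and \<epsilon>: "\<epsilon> > 0" for A \<epsilon>
  proof -
    \<comment> \<open>In turn: \<open>X\<close> comes closer than \<epsilon> to \<open>A\<close>;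
      the rejection of \<open>sgn q'\<close> loses at most half of its lower bound \<open>c\<close>;
      the defect per unit length of \<open>q'\<close> stays below \<open>e * c / 2\<close>, the
      other half of which is the radius around \<open>A\<^sub>0\<close>.\<close>
    define \<eta> where "\<eta> = min (\<epsilon> / 2) (min (c / 2) (e * c / 4))"
    have "e * c > 0" using c(1) e(1) by simp
    then have "\<eta> > 0" "\<eta> \<le> \<epsilon> / 2" "\<eta> \<le> c / 2" "\<eta> \<le> e * c / 4"
      unfolding \<eta>_def using \<epsilon> c(1) by (simp_all only: min_less_iff_conj min.cobounded1 min.coboundedI2 half_gt_zero) simp_all
    then have \<eta>: "\<eta> > 0" "\<eta> < \<epsilon>" "\<eta> \<le> c / 2" "\<eta> \<le> e * c / 4"
      using \<epsilon> by linarith+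
    obtain \<theta> p' q' where *: "\<theta> \<in> V" "norm \<theta> = 1" "p' \<in> P" "q' \<in> Q" "C \<le> norm q'" "q' \<noteq> 0"
      "norm (sgn q' - \<theta>) < \<eta> \<or> norm (sgn q' + \<theta>) < \<eta>" "norm (p' - A *v q') \<le> \<eta> * norm q'"
      using P H V(1-3) \<eta>(1) by (rule fibre_near_matrix)
    obtain X where X: "X *v q' = p'" "norm (X - A) \<le> \<eta>"
      using fibre_point_near[OF *(8,6)] by metis
    define w where "w = reject q q'"
    have "c / 2 \<le> norm (reject q (sgn q'))"
    proof -
      \<comment> \<open>Here \<open>x\<close> is whichever of \<open>\<theta>\<close> and
        \<open>- \<theta>\<close> the direction of \<open>q'\<close> is close to.\<close>
      obtain x where x: "x \<in> V" "norm x = 1" "norm (sgn q' - x) < \<eta>"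
        using *(1,2,7) that V(1) subspace_neg[of V \<theta>] by (metis diff_minus_eq_add norm_minus_cancel)
      have "norm (reject q x) - norm (reject q (sgn q')) \<le> norm (reject q (sgn q' - x))"
        unfolding reject_diff by (metis norm_minus_commute norm_triangle_ineq2)
      also have "\<dots> < \<eta>" using norm_reject_le[of q "sgn q' - x"] x(3) by linarith
      finally show ?thesis using c(2)[OF x(1,2)] \<eta>(3) by linarith
    qed
    moreover have "norm w = norm q' * norm (reject q (sgn q'))"
      using *(6) by (simp add: w_def sgn_div_norm reject_scaleR)
    ultimately have w: "norm q' * (c / 2) \<le> norm w"
      using mult_left_mono[of "c / 2" _ "norm q'"] by simp
    have "norm w > 0" using w *(6) c(1) by (smt (verit) half_gt_zero mult_pos_pos zero_less_norm_iff)
    define A' where "A' = A\<^sub>0 + outer (p' - A\<^sub>0 *v q') ((1 / (norm w)\<^sup>2) *\<^sub>R w)"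
    have A': "A' *v q' = p'" "A' *v q = A\<^sub>0 *v q"
        "norm (A' - A\<^sub>0) = norm (p' - A\<^sub>0 *v q') * norm w / \<bar>(norm w)\<^sup>2\<bar>"
      unfolding A'_def using \<open>norm w > 0\<close>
      by (intro fibre_correction; simp add: w_def reject_inner_left reject_inner_right)+
    have "norm (p' - A\<^sub>0 *v q') \<le> norm (p' - A *v q') + norm ((A - A\<^sub>0) *v q')"
      using norm_triangle_ineq[of "p' - A *v q'" "(A - A\<^sub>0) *v q'"]
      by (simp add: matrix_vector_mult_diff_rdistrib)
    also have "norm ((A - A\<^sub>0) *v q') \<le> norm (A - A\<^sub>0) * norm q'"
      by (rule norm_matrix_vector_mult_le)
    also have "norm (p' - A *v q') + norm (A - A\<^sub>0) * norm q' \<le> (\<eta> + norm (A - A\<^sub>0)) * norm q'"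
      using *(8) by (simp add: distrib_right)
    finally have n: "norm (p' - A\<^sub>0 *v q') \<le> (\<eta> + norm (A - A\<^sub>0)) * norm q'" by simp
    have "norm (A - A\<^sub>0) < e * c / 4" using A by (simp add: dist_norm norm_minus_commute)
    have "norm (A' - A\<^sub>0) = norm (p' - A\<^sub>0 *v q') / norm w"
      using A'(3) \<open>norm w > 0\<close> by (simp add: power2_eq_square)
    also have "\<dots> < e"
    proof -
      have "(\<eta> + norm (A - A\<^sub>0)) * norm q' < (e * c / 2) * norm q'"
        using \<eta>(4) \<open>norm (A - A\<^sub>0) < e * c / 4\<close> *(6) by (intro mult_strict_right_mono) auto
      also have "\<dots> = e * (norm q' * (c / 2))" by simp
      also have "\<dots> \<le> e * norm w" using w e(1) by (intro mult_left_mono) auto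
      finally have "norm (p' - A\<^sub>0 *v q') < e * norm w" using n by linarith
      then show ?thesis using \<open>norm w > 0\<close> by (simp add: divide_less_eq)
    qed
    finally have "A' \<in> W" using e(2) by (auto simp: dist_norm norm_minus_commute)
    moreover have "dist X A < \<epsilon>" using X(2) \<eta>(2) by (simp add: dist_norm)
    ultimately show ?thesis
      using *(3,4,5) A'(1,2) A0 X(1) by (intro bexI[of _ p'] bexI[of _ q'] exI[of _ A'] exI[of _ X]) simp_all
  qed
  moreover have "A\<^sub>0 \<in> ball A\<^sub>0 (e * c / 4)" using e(1) c(1) by simp
  ultimately show "\<exists>O'. open O' \<and> A\<^sub>0 \<in> O' \<and> (\<forall>A\<in>O'. \<forall>\<epsilon>>0. \<exists>p'\<in>P. \<exists>q'\<in>Q. \<exists>A' X.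
      C \<le> norm q' \<and> A' \<in> W \<and> A' *v q = p \<and> A' *v q' = p' \<and> X *v q' = p' \<and> dist X A < \<epsilon>)"
    by (intro exI[of _ "ball A\<^sub>0 (e * c / 4)"]) simp
qed

text \<open>The open set supplied by transversality lies in the closure of the fibres meeting
  \<open>L\<close> inside \<open>W\<close>.\<close>

lemma totally_dense_mat_fibres:
  fixes P :: "(real^'m) set" and Q :: "(real^'n) set"
  assumes tr: "transversal P Q" and "0 \<notin> Q"
    and dense: "\<And>A \<epsilon>. \<epsilon> > 0 \<Longrightarrow> \<exists>p\<in>P. \<exists>q\<in>Q. \<exists>X. X *v q = p \<and> dist X A < \<epsilon>"
  shows "totally_dense (mat_fibres P Q)"
  unfolding totally_dense_def dense_collection_def
proof (intro conjI ballI allI impI)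
  fix L assume "L \<in> mat_fibres P Q"
  then obtain p q where L: "L = mat_fibre p q" "p \<in> P" "q \<in> Q" by (auto simp: mat_fibres_def)
  have "continuous_on UNIV (\<lambda>A::real^'n^'m. A *v q)"
    unfolding matrix_vector_mult_def by (intro continuous_intros)
  then have "closed {A \<in> UNIV. A *v q = p}"
    by (rule continuous_closed_preimage_constant) simp
  then show "closed L" by (simp add: L mat_fibre_def)
  have "q \<noteq> 0" using L assms(2) by auto
  \<comment> \<open>A matrix off the fibre: \<open>1\<close> is the all-ones vector, so
    \<open>p + 1\<close> differs from \<open>p\<close>.\<close>
  have "outer (p + 1) ((1 / (q \<bullet> q)) *\<^sub>R q) *v q = p + 1"
    using \<open>q \<noteq> 0\<close> by (simp add: outer_mult_vector)
  then have "outer (p + 1) ((1 / (q \<bullet> q)) *\<^sub>R q) \<notin> L"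
    by (simp add: L(1) mat_fibre_def)
  then show "L \<noteq> UNIV" by blast
next
  show "closure (\<Union>(mat_fibres P Q)) = UNIV"
  proof (intro equalityI subsetI)
    fix A :: "real^'n^'m"
    show "A \<in> closure (\<Union>(mat_fibres P Q))"
      unfolding closure_approachable
    proof (intro allI impI)
      fix \<epsilon> :: real assume "\<epsilon> > 0"
      from dense[OF this, of A] obtain p q X where *: "p \<in> P" "q \<in> Q" "X *v q = p" "dist X A < \<epsilon>"
        by blast
      have "X \<in> mat_fibre p q" "mat_fibre p q \<in> mat_fibres P Q"
        using *(1-3) by (auto simp: mat_fibres_def mat_fibre_def)
      then show "\<exists>y\<in>\<Union>(mat_fibres P Q). dist y A < \<epsilon>"
        using *(4) by blast
    qed
  qed simp
next
  fix W L
  assume "L \<in> mat_fibres P Q" and W: "open W" "L \<inter> W \<noteq> {}"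
  then obtain p q A\<^sub>0 where L: "L = mat_fibre p q" "p \<in> P" "q \<in> Q" "A\<^sub>0 \<in> W" "A\<^sub>0 *v q = p"
    by (auto simp: mat_fibres_def mat_fibre_def)
  obtain O' where O': "open O'" "A\<^sub>0 \<in> O'" "\<forall>A\<in>O'. \<forall>\<epsilon>>0. \<exists>p'\<in>P. \<exists>q'\<in>Q. \<exists>A' X.
      0 \<le> norm q' \<and> A' \<in> W \<and> A' *v q = p \<and> A' *v q' = p' \<and> X *v q' = p' \<and> dist X A < \<epsilon>"
    using tr L(2,3) W(1) L(4,5) by (rule transversalD[where C=0])
  have "O' \<subseteq> closure (\<Union>{L' \<in> mat_fibres P Q. L' \<inter> L \<inter> W \<noteq> {}})"
  proof
    fix A assume A: "A \<in> O'"
    show "A \<in> closure (\<Union>{L' \<in> mat_fibres P Q. L' \<inter> L \<inter> W \<noteq> {}})"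
      unfolding closure_approachable
    proof (intro allI impI)
      fix \<epsilon> :: real assume "\<epsilon> > 0"
      obtain p' q' A' X where *: "p' \<in> P" "q' \<in> Q" "A' \<in> W" "A' *v q = p" "A' *v q' = p'"
          "X *v q' = p'" "dist X A < \<epsilon>"
        using O'(3)[rule_format, OF A \<open>\<epsilon> > 0\<close>] by blast
      have "A' \<in> mat_fibre p' q' \<inter> L \<inter> W" using * L(1) by (simp add: mat_fibre_def)
      moreover have "mat_fibre p' q' \<in> mat_fibres P Q" using *(1,2) by (auto simp: mat_fibres_def)
      moreover have "X \<in> mat_fibre p' q'" using *(6) by (simp add: mat_fibre_def)
      ultimately show "\<exists>y\<in>\<Union>{L' \<in> mat_fibres P Q. L' \<inter> L \<inter> W \<noteq> {}}. dist y A < \<epsilon>"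
        using *(7) by blast
    qed
  qed
  then have "O' \<subseteq> interior (closure (\<Union>{L' \<in> mat_fibres P Q. L' \<inter> L \<inter> W \<noteq> {}}))"
    using O'(1) by (rule interior_maximal)
  then show "interior (closure (\<Union>{L' \<in> mat_fibres P Q. L' \<inter> L \<inter> W \<noteq> {}})) \<noteq> {}"
    using O'(2) by blast
qed

subsection \<open>Nested balls\<close>

text \<open>If the current fibre has a point of \<open>W\<close> outside \<open>Z\<close>, the
  intersection is sought near that point. If not, the new fibre is chosen to pass through a point
  \<open>X\<close> of \<open>D\<close>; the line from \<open>A'\<close> to \<open>X\<close> stays in
  this fibre and leaves \<open>Z\<close> arbitrarily early.\<close>

lemma transversal_escape_thin:
  fixes A\<^sub>0 :: "real^'n^'m"
  assumes tr: "transversal P Q" and pq: "p \<in> P" "q \<in> Q" and W: "open W" "A\<^sub>0 \<in> W" "A\<^sub>0 *v q = p"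
    and Z: "thin Z"
  obtains p' q' A' where "p' \<in> P" "q' \<in> Q" "C \<le> norm q'" "A' \<in> W" "A' *v q = p" "A' *v q' = p'"
    "\<forall>e>0. \<exists>B. dist B A' < e \<and> B *v q' = p' \<and> B \<notin> Z"
proof (cases "\<exists>A\<^sub>1\<in>W. A\<^sub>1 *v q = p \<and> A\<^sub>1 \<notin> Z")
  case True
  then obtain A\<^sub>1 where A1: "A\<^sub>1 \<in> W - Z" "A\<^sub>1 *v q = p" by blast
  have "open (W - Z)" using W(1) Z by (auto simp: thin_def)
  obtain O' where "open O'" "A\<^sub>1 \<in> O'" "\<forall>A\<in>O'. \<forall>\<epsilon>>0. \<exists>p'\<in>P. \<exists>q'\<in>Q. \<exists>A' X.
      C \<le> norm q' \<and> A' \<in> W - Z \<and> A' *v q = p \<and> A' *v q' = p' \<and> X *v q' = p' \<and> dist X A < \<epsilon>"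
    using tr pq \<open>open (W - Z)\<close> A1 by (rule transversalD[where C=C])
  from this(3)[rule_format, OF this(2) zero_less_one] obtain p' q' A' where *: "p' \<in> P" "q' \<in> Q" "C \<le> norm q'"
      "A' \<in> W - Z" "A' *v q = p" "A' *v q' = p'"
    by blast
  show ?thesis
    using * by (intro that[of p' q' A']) (auto intro!: exI[of _ A'])
next
  case False
  have inZ: "A \<in> Z" if "A \<in> W" "A *v q = p" for A using that False by blast
  obtain D where D: "open D" "Z \<subseteq> closure D"
      "\<And>x y e. x \<in> Z \<Longrightarrow> y \<in> D \<Longrightarrow> e > 0 \<Longrightarrow> \<exists>s. 0 < s \<and> s < e \<and> x + s *\<^sub>R (y - x) \<notin> Z"
    using Z unfolding thin_def by blast
  obtain O' where O': "open O'" "A\<^sub>0 \<in> O'" "\<forall>A\<in>O'. \<forall>\<epsilon>>0. \<exists>p'\<in>P. \<exists>q'\<in>Q. \<exists>A' X.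
      C \<le> norm q' \<and> A' \<in> W \<and> A' *v q = p \<and> A' *v q' = p' \<and> X *v q' = p' \<and> dist X A < \<epsilon>"
    using tr pq W by (rule transversalD[where C=C])
  have "A\<^sub>0 \<in> closure D" using inZ W D(2) by blast
  then have "O' \<inter> D \<noteq> {}"
    using O'(1,2) open_Int_closure_eq_empty[of O' D] by blast
  then obtain A where A: "A \<in> O'" "A \<in> D" by blast
  then obtain \<epsilon> where \<epsilon>: "\<epsilon> > 0" "ball A \<epsilon> \<subseteq> D" using D(1) open_contains_ball by blast
  obtain p' q' A' X where *: "p' \<in> P" "q' \<in> Q" "C \<le> norm q'" "A' \<in> W" "A' *v q = p"
      "A' *v q' = p'" "X *v q' = p'" "dist X A < \<epsilon>"
    using O'(3)[rule_format, OF A(1) \<epsilon>(1)] by blast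
  have "X \<in> D" using *(8) \<epsilon>(2) by (auto simp: dist_commute)
  have "\<exists>B. dist B A' < e \<and> B *v q' = p' \<and> B \<notin> Z" if "e > 0" for e
  proof -
    \<comment> \<open>The summand 1 makes the divisor positive without a separate proof that
      \<open>X\<close> differs from \<open>A'\<close>.\<close>
    define \<kappa> where "\<kappa> = norm (X - A') + 1"
    have "\<kappa> > 0" by (simp add: \<kappa>_def add_nonneg_pos)
    obtain s where s: "0 < s" "s < e / \<kappa>" "A' + s *\<^sub>R (X - A') \<notin> Z"
      using D(3)[OF inZ[OF *(4,5)] \<open>X \<in> D\<close> divide_pos_pos[OF \<open>e > 0\<close> \<open>\<kappa> > 0\<close>]] by blast
    have "s * norm (X - A') \<le> s * \<kappa>" using s(1) by (simp add: \<kappa>_def)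
    also have "\<dots> < e" using s(2) \<open>\<kappa> > 0\<close> by (simp add: less_divide_eq)
    finally have "dist (A' + s *\<^sub>R (X - A')) A' < e" using s(1) by (simp add: dist_norm)
    moreover have "(A' + s *\<^sub>R (X - A')) *v q' = p'"
      using *(6,7) by (simp add: matrix_vector_mult_add_rdistrib matrix_vector_mult_diff_rdistrib
          scaleR_matrix_vector_assoc[symmetric])
    ultimately show ?thesis using s(3) by blast
  qed
  then show ?thesis using *(1-6) that by blast
qed

text \<open>At the intersection point \<open>A'\<close> the old defect \<open>A *v q - p\<close> is
  zero, so it is below the positive number \<open>\<psi> (infnorm q')\<close> in a neighbourhood.
  The new centre is taken there, on the new fibre and off \<open>Z\<close>.\<close>

lemma transversal_step:
  fixes A\<^sub>0 :: "real^'n^'m" and \<psi> :: "real \<Rightarrow> real"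
  assumes tr: "transversal P Q" and pq: "p \<in> P" "q \<in> Q" and W: "open W" "A\<^sub>0 \<in> W" "A\<^sub>0 *v q = p"
    and Z: "thin Z" and \<psi>: "\<And>t. t > 0 \<Longrightarrow> \<psi> t > 0" and C: "C > 0"
  obtains p' q' B r where "p' \<in> P" "q' \<in> Q" "C \<le> norm q'" "B *v q' = p'" "r > 0"
    "cball B r \<subseteq> W" "cball B r \<inter> Z = {}" "\<forall>A\<in>cball B r. infnorm (A *v q - p) \<le> \<psi> (infnorm q')"
proof -
  obtain p' q' A' where *: "p' \<in> P" "q' \<in> Q" "C \<le> norm q'" "A' \<in> W" "A' *v q = p" "A' *v q' = p'"
    "\<forall>e>0. \<exists>B. dist B A' < e \<and> B *v q' = p' \<and> B \<notin> Z"
    using tr pq W Z by (rule transversal_escape_thin[where C=C])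
  have "q' \<noteq> 0" using *(3) C by auto
  then have pos: "\<psi> (infnorm q') > 0" by (intro \<psi>) (simp add: infnorm_pos_lt)
  define G where "G = W \<inter> (\<lambda>A. norm (A *v q - p)) -` {..<\<psi> (infnorm q')}"
  have "continuous_on UNIV (\<lambda>A::real^'n^'m. norm (A *v q - p))"
    unfolding matrix_vector_mult_def by (intro continuous_intros)
  then have "open ((\<lambda>A::real^'n^'m. norm (A *v q - p)) -` {..<\<psi> (infnorm q')})"
    by (intro open_vimage) auto
  then have "open G" unfolding G_def using W(1) by (intro open_Int)
  moreover have "A' \<in> G" using *(4,5) pos by (simp add: G_def)
  ultimately obtain e where e: "e > 0" "ball A' e \<subseteq> G" using open_contains_ball by blast
  obtain B where B: "dist B A' < e" "B *v q' = p'" "B \<notin> Z" using *(7)[rule_format, OF e(1)] by blast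
  have "open (G - Z)" using \<open>open G\<close> Z by (auto simp: thin_def)
  moreover have "B \<in> G - Z" using B e(2) by (auto simp: dist_commute)
  ultimately obtain r where r: "r > 0" "cball B r \<subseteq> G - Z" using open_contains_cball by blast
  have "infnorm (A *v q - p) \<le> \<psi> (infnorm q')" if "A \<in> cball B r" for A
  proof -
    have "A \<in> G" using that r(2) by blast
    then show ?thesis using infnorm_le_norm[of "A *v q - p"] by (simp add: G_def)
  qed
  then show ?thesis
    using r(2) by (intro that[OF *(1-3) B(2) r(1)]) (auto simp: G_def)
qed

text \<open>The old pair has to serve for all \<open>t\<close> up to the size of the next
  \<open>q\<close>, which is why its defect is bounded by \<psi> at the next size. A common point of
  the nested balls then has an approximation for every large \<open>t\<close>.\<close>

lemma UA_meets_open: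
  fixes P :: "(real^'m) set" and Q :: "(real^'n) set" and \<psi> :: "real \<Rightarrow> real"
    and \<Z> :: "(real^'n^'m) set set"
  assumes tr: "transversal P Q"
    and dense: "\<And>A \<epsilon>. \<epsilon> > 0 \<Longrightarrow> \<exists>p\<in>P. \<exists>q\<in>Q. \<exists>X. X *v q = p \<and> dist X A < \<epsilon>"
    and \<psi>: "\<And>t. t > 0 \<Longrightarrow> \<psi> t > 0" "antimono_on {0<..} \<psi>"
    and \<Z>: "countable \<Z>" "\<And>Z. Z \<in> \<Z> \<Longrightarrow> thin Z" and G: "open G" "G \<noteq> {}"
  shows "\<exists>A\<in>G. A \<in> UA P Q \<psi> \<and> A \<notin> \<Union>\<Z>"
proof -
  \<comment> \<open>Adding the thin set \<open>{0}\<close> makes the collection nonempty, so that it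
    can be enumerated.\<close>
  define Z where "Z = from_nat_into (insert {0} \<Z>)"
  have thinZ: "thin (Z n)" for n
    using from_nat_into[of "insert {0} \<Z>" n] \<Z>(2) thin_singleton by (auto simp: Z_def)
  have rangeZ: "\<Z> \<subseteq> range Z"
    using range_from_nat_into[of "insert {0} \<Z>"] \<Z>(1) by (auto simp: Z_def)
  \<comment> \<open>A state is a ball centred on the fibre of its pair; the bound
    \<open>real n\<close> makes the vectors \<open>q\<close> unbounded.\<close>
  define good where "good n x \<longleftrightarrow> (case x of (p, q, B, r) \<Rightarrow> p \<in> P \<and> q \<in> Q \<and> B *v q = p \<and> r > 0 \<and>
      cball B r \<subseteq> G \<and> real n \<le> norm q)"
    for n and x :: "(real^'m) \<times> (real^'n) \<times> (real^'n^'m) \<times> real"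
  define next' where "next' n x y \<longleftrightarrow> (case x of (p, q, B, r) \<Rightarrow> case y of (p', q', B', r') \<Rightarrow>
      cball B' r' \<subseteq> cball B r \<and> cball B' r' \<inter> Z n = {} \<and>
      (\<forall>A\<in>cball B' r'. infnorm (A *v q - p) \<le> \<psi> (infnorm q')))"
    for n and x y :: "(real^'m) \<times> (real^'n) \<times> (real^'n^'m) \<times> real"
  have "\<exists>f. \<forall>n. good n (f n) \<and> next' n (f n) (f (Suc n))"
  proof (rule dependent_nat_choice)
    obtain A e where A: "e > 0" "ball A e \<subseteq> G" using G open_contains_ball by blast
    obtain p q X where X: "p \<in> P" "q \<in> Q" "X *v q = p" "dist X A < e"
      using dense[OF A(1), of A] by blast
    have "X \<in> G" using X(4) A(2) by (auto simp: dist_commute)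
    then obtain r where "r > 0" "cball X r \<subseteq> G" using G(1) open_contains_cball by blast
    then show "\<exists>x. good 0 x"
      using X by (intro exI[of _ "(p, q, X, r)"]) (simp add: good_def)
  next
    fix x n assume "good n x"
    obtain p q B r where x: "x = (p, q, B, r)" by (rule prod_cases4)
    have g: "p \<in> P" "q \<in> Q" "B *v q = p" "r > 0" "cball B r \<subseteq> G"
      using \<open>good n x\<close> by (simp_all add: good_def x)
    have "B \<in> ball B r" using g(4) by simp
    have "0 < real (Suc n)" by simp
    obtain p' q' B' r' where *: "p' \<in> P" "q' \<in> Q" "real (Suc n) \<le> norm q'" "B' *v q' = p'" "r' > 0"
        "cball B' r' \<subseteq> ball B r" "cball B' r' \<inter> Z n = {}"
        "\<forall>A\<in>cball B' r'. infnorm (A *v q - p) \<le> \<psi> (infnorm q')"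
      using tr g(1,2) open_ball \<open>B \<in> ball B r\<close> g(3) thinZ[of n] \<psi>(1) \<open>0 < real (Suc n)\<close>
      by (rule transversal_step)
    have "cball B' r' \<subseteq> cball B r" using *(6) ball_subset_cball[of B r] by blast
    then show "\<exists>y. good (Suc n) y \<and> next' n x y"
      using * g(5) by (intro exI[of _ "(p', q', B', r')"]) (auto simp: good_def next'_def x)
  qed
  then obtain f where f: "\<And>n. good n (f n)" "\<And>n. next' n (f n) (f (Suc n))" by blast
  define p q B r where "p n = fst (f n)" and "q n = fst (snd (f n))" and "B n = fst (snd (snd (f n)))"
    and "r n = snd (snd (snd (f n)))" for n
  have feq: "f n = (p n, q n, B n, r n)" for n by (simp add: p_def q_def B_def r_def)
  have g: "p n \<in> P" "q n \<in> Q" "r n > 0" "cball (B n) (r n) \<subseteq> G" "real n \<le> norm (q n)" for n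
    using f(1)[of n] by (simp_all add: good_def feq)
  have nx: "cball (B (Suc n)) (r (Suc n)) \<subseteq> cball (B n) (r n)"
      "cball (B (Suc n)) (r (Suc n)) \<inter> Z n = {}"
      "\<forall>A\<in>cball (B (Suc n)) (r (Suc n)). infnorm (A *v q n - p n) \<le> \<psi> (infnorm (q (Suc n)))" for n
    using f(2)[of n] by (simp_all add: next'_def feq)
  have "(\<Inter>n. cball (B n) (r n)) \<noteq> {}"
  proof (rule compact_nest)
    show "cball (B n) (r n) \<noteq> {}" for n using g(3)[of n] by simp
    show "cball (B n) (r n) \<subseteq> cball (B m) (r m)" if "m \<le> n" for m n
      using nx(1) that by (rule lift_Suc_antimono_le)
  qed simp
  then obtain A where A: "\<And>n. A \<in> cball (B n) (r n)" by blast
  have "A \<in> UA P Q \<psi>"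
    unfolding UA_def mem_Collect_eq eventually_at_top_linorder
  proof (intro exI allI impI)
    \<comment> \<open>The 1 makes \<open>t\<close> positive, where \<psi> is monotone; the other
      bound prevents the index \<open>k\<close> below from being 0.\<close>
    fix t assume t: "max 1 (infnorm (q 0)) \<le> t"
    have "\<exists>n. infnorm (q n) > t"
    proof -
      obtain n where n: "real n > sqrt DIM(real^'n) * t" using reals_Archimedean2 by blast
      then have "sqrt DIM(real^'n) * t < sqrt DIM(real^'n) * infnorm (q n)"
        using g(5)[of n] norm_le_infnorm[of "q n"] by linarith
      then have "t < infnorm (q n)"
        by (rule mult_left_less_imp_less) simp
      then show ?thesis ..
    qed
    \<comment> \<open>The sizes of the \<open>q n\<close> need not increase. The first one to exceed
      \<open>t\<close> still has a predecessor of size at most \<open>t\<close>, whose defect it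
      controls.\<close>
    define k where "k = (LEAST n. infnorm (q n) > t)"
    have k: "infnorm (q k) > t" unfolding k_def using \<open>\<exists>n. infnorm (q n) > t\<close> by (rule LeastI_ex)
    have "k \<noteq> 0" using k t by (intro notI) simp
    then obtain j where j: "k = Suc j" by (cases k) auto
    have "infnorm (q j) \<le> t"
      using not_less_Least[of j "\<lambda>n. infnorm (q n) > t"] j by (simp add: k_def)
    moreover have "infnorm (A *v q j - p j) \<le> \<psi> (infnorm (q k))"
      using nx(3)[of j] A[of "Suc j"] j by blast
    moreover have "\<psi> (infnorm (q k)) \<le> \<psi> t"
      using t k by (intro monotone_onD[OF \<psi>(2)]) auto
    ultimately show "\<exists>p\<in>P. \<exists>q\<in>Q. infnorm (A *v q - p) \<le> \<psi> t \<and> infnorm q \<le> t"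
      using g(1,2)[of j] by (intro bexI[of _ "p j"] bexI[of _ "q j"]) auto
  qed
  moreover have "A \<notin> Z n" for n using A[of "Suc n"] nx(2)[of n] by blast
  then have "A \<notin> \<Union>\<Z>" using rangeZ by blast
  moreover have "A \<in> G" using A[of 0] g(4)[of 0] by blast
  ultimately show ?thesis by blast
qed

text \<open>Any countable set \<open>S\<close> can be avoided as well, as a union of thin
  singletons. Letting \<open>S\<close> be the whole difference set contradicts its countability, and
  \<open>S\<close> empty gives density.\<close>

lemma UA_Diff_submanifolds:
  fixes P :: "(real^'m) set" and Q :: "(real^'n) set" and \<psi> :: "real \<Rightarrow> real"
    and \<R> :: "(real^'n^'m) set set"
  assumes tr: "transversal P Q"
    and dense: "\<And>A \<epsilon>. \<epsilon> > 0 \<Longrightarrow> \<exists>p\<in>P. \<exists>q\<in>Q. \<exists>X. X *v q = p \<and> dist X A < \<epsilon>"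
    and \<psi>: "\<And>t. t > 0 \<Longrightarrow> \<psi> t > 0" "antimono_on {0<..} \<psi>"
    and \<R>: "countable \<R>" "\<And>R. R \<in> \<R> \<Longrightarrow> proper_analytic_submanifold R"
  shows "uncountable (UA P Q \<psi> - \<Union>\<R>) \<and> closure (UA P Q \<psi> - \<Union>\<R>) = UNIV"
proof -
  have "\<exists>\<Z>. countable \<Z> \<and> (\<forall>Z\<in>\<Z>. thin Z) \<and> R \<subseteq> \<Union>\<Z>" if "R \<in> \<R>" for R
    by (rule proper_analytic_submanifold_thin_cover[OF \<R>(2)[OF that]]) blast
  then obtain cov where cov: "\<And>R. R \<in> \<R> \<Longrightarrow> countable (cov R)"
      "\<And>R Z. R \<in> \<R> \<Longrightarrow> Z \<in> cov R \<Longrightarrow> thin Z" "\<And>R. R \<in> \<R> \<Longrightarrow> R \<subseteq> \<Union>(cov R)"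
    by metis
  have hit: "\<exists>A\<in>G. A \<in> UA P Q \<psi> - \<Union>\<R> - S" if "countable S" and G: "open G" "G \<noteq> {}" for S G
  proof -
    define \<Z> where "\<Z> = (\<Union>R\<in>\<R>. cov R) \<union> (\<lambda>x. {x}) ` S"
    have "countable \<Z>" using \<R>(1) cov(1) that by (simp add: \<Z>_def)
    moreover have "thin Z" if "Z \<in> \<Z>" for Z
      using that cov(2) thin_singleton by (auto simp: \<Z>_def)
    ultimately obtain A where A: "A \<in> G" "A \<in> UA P Q \<psi>" "A \<notin> \<Union>\<Z>"
      using UA_meets_open[OF tr dense \<psi> _ _ G, of \<Z>] by blast
    have "A \<notin> \<Union>\<R>"
    proof
      assume "A \<in> \<Union>\<R>"
      then obtain R where "R \<in> \<R>" "A \<in> \<Union>(cov R)" using cov(3) by blast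
      then show False using A(3) by (auto simp: \<Z>_def)
    qed
    moreover have "A \<notin> S" using A(3) by (auto simp: \<Z>_def)
    ultimately show ?thesis using A by blast
  qed
  have "uncountable (UA P Q \<psi> - \<Union>\<R>)"
  proof
    assume "countable (UA P Q \<psi> - \<Union>\<R>)"
    from hit[OF this open_UNIV] show False by simp
  qed
  moreover have "A \<in> closure (UA P Q \<psi> - \<Union>\<R>)" for A
    unfolding closure_approachable
  proof (intro allI impI)
    fix e :: real assume "e > 0"
    then have "ball A e \<noteq> {}" by simp
    from hit[OF countable_empty open_ball this]
    obtain B where "B \<in> ball A e" "B \<in> UA P Q \<psi> - \<Union>\<R>" by blast
    then show "\<exists>y\<in>UA P Q \<psi> - \<Union>\<R>. dist y A < e"
      by (intro bexI[of _ B]) (auto simp: dist_commute)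
  qed
  ultimately show ?thesis by blast
qed

theorem theorem1p6:
  fixes k :: nat
    and P H :: "(real^'m) set"
    and Q :: "(real^'n) set"
  assumes "k + 2 \<le> CARD('n)" and "k \<le> CARD('m)"
    and "P \<noteq> {}"
    and "subspace H" and "dim H = CARD('m) - k"
    and "log_dense_in P H"
    and "0 \<notin> Q"
    and "\<forall>C>0. \<exists>\<Phi>\<^sub>1 \<Phi>\<^sub>2. halfsphere k \<Phi>\<^sub>1 \<and> halfsphere k \<Phi>\<^sub>2 \<and>
           \<not> (\<exists>S. subsphere k S \<and> \<Phi>\<^sub>1 \<subseteq> S \<and> \<Phi>\<^sub>2 \<subseteq> S) \<and>
           \<Phi>\<^sub>1 \<union> \<Phi>\<^sub>2 \<subseteq> closure (sgn ` (Q - ball 0 C))"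
  shows "(\<exists>\<L> \<subseteq> mat_fibres P Q. totally_dense \<L>) \<and>
    (\<forall>\<psi> :: real \<Rightarrow> real. \<forall>\<R> :: (real^'n^'m) set set.
       (\<forall>t>0. \<psi> t > 0) \<longrightarrow> antimono_on {0<..} \<psi> \<longrightarrow>
       countable \<R> \<longrightarrow> (\<forall>R\<in>\<R>. proper_analytic_submanifold R) \<longrightarrow>
       uncountable (UA P Q \<psi> - \<Union>\<R>) \<and> closure (UA P Q \<psi> - \<Union>\<R>) = UNIV)"
proof -
  have two: "\<exists>V\<^sub>1 V\<^sub>2. subspace V\<^sub>1 \<and> dim V\<^sub>1 = k + 1 \<and> approximates Q C V\<^sub>1 \<and>
      subspace V\<^sub>2 \<and> dim V\<^sub>2 = k + 1 \<and> approximates Q C V\<^sub>2 \<and> V\<^sub>1 \<noteq> V\<^sub>2" if "C > 0" for C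
  proof -
    obtain \<Phi>\<^sub>1 \<Phi>\<^sub>2 where \<Phi>: "halfsphere k \<Phi>\<^sub>1" "halfsphere k \<Phi>\<^sub>2"
        "\<not> (\<exists>S. subsphere k S \<and> \<Phi>\<^sub>1 \<subseteq> S \<and> \<Phi>\<^sub>2 \<subseteq> S)"
        "\<Phi>\<^sub>1 \<union> \<Phi>\<^sub>2 \<subseteq> closure (sgn ` (Q - ball 0 C))"
      using assms(8)[rule_format, OF \<open>C > 0\<close>] by (elim exE conjE)
    have cl: "\<Phi>\<^sub>1 \<subseteq> closure (sgn ` (Q - ball 0 C))" "\<Phi>\<^sub>2 \<subseteq> closure (sgn ` (Q - ball 0 C))"
      using \<Phi>(4) by simp_all
    obtain V\<^sub>1 where V1: "subspace V\<^sub>1" "dim V\<^sub>1 = k + 1" "\<Phi>\<^sub>1 \<subseteq> V\<^sub>1 \<inter> sphere 0 1" "approximates Q C V\<^sub>1"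
      using halfsphere_approximates[OF \<Phi>(1) cl(1)] by metis
    obtain V\<^sub>2 where V2: "subspace V\<^sub>2" "dim V\<^sub>2 = k + 1" "\<Phi>\<^sub>2 \<subseteq> V\<^sub>2 \<inter> sphere 0 1" "approximates Q C V\<^sub>2"
      using halfsphere_approximates[OF \<Phi>(2) cl(2)] by metis
    \<comment> \<open>Equal subspaces would put both halfspheres into one subsphere.\<close>
    have "V\<^sub>1 \<noteq> V\<^sub>2"
    proof
      assume "V\<^sub>1 = V\<^sub>2"
      moreover have "subsphere k (V\<^sub>1 \<inter> sphere 0 1)" using V1(1,2) by (auto simp: subsphere_def)
      ultimately show False using \<Phi>(3) V1(3) V2(3) by blast
    qed
    then show ?thesis using V1 V2 by blast
  qed
  \<comment> \<open>Everything is proved for \<open>Q'\<close> and carried over to \<open>Q\<close>,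
    as both the collection of fibres and \<open>UA\<close> grow with \<open>Q\<close>.\<close>
  obtain Q' where Q': "Q' \<subseteq> Q" "\<exists>V. subspace V \<and> dim V = k + 1 \<and> (\<forall>C. approximates Q' C V)"
      "\<forall>q\<in>Q'. \<exists>V. subspace V \<and> dim V = k + 1 \<and> (\<forall>C. approximates Q' C V) \<and> q \<notin> V"
    by (rule exists_transverse_subset[OF two])
  obtain V where V: "subspace V" "dim V = k + 1" "\<And>C. approximates Q' C V" using Q'(2) by blast
  have tr: "transversal P Q'"
    by (rule transversalI[OF assms(6,3,4,5,2) Q'(3)[rule_format]])
  have dense: "\<exists>p\<in>P. \<exists>q\<in>Q'. \<exists>X. X *v q = p \<and> dist X A < \<epsilon>" if "\<epsilon> > 0" for A :: "real^'n^'m" and \<epsilon>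
  proof -
    have "\<epsilon> / 2 > 0" using that by simp
    obtain \<theta> p q where *: "\<theta> \<in> V" "norm \<theta> = 1" "p \<in> P" "q \<in> Q'" "0 \<le> norm q" "q \<noteq> 0"
      "norm (sgn q - \<theta>) < \<epsilon> / 2 \<or> norm (sgn q + \<theta>) < \<epsilon> / 2" "norm (p - A *v q) \<le> \<epsilon> / 2 * norm q"
      using assms(6,3,4,5,2) V \<open>\<epsilon> / 2 > 0\<close> by (rule fibre_near_matrix[where C=0])
    obtain X where "X *v q = p" "norm (X - A) \<le> \<epsilon> / 2"
      using fibre_point_near[OF *(8,6)] by metis
    then show ?thesis
      using *(3,4) that by (intro bexI[of _ p] bexI[of _ q] exI[of _ X]) (auto simp: dist_norm)
  qed
  have UA_mono: "UA P Q' \<psi> - \<Union>\<R> \<subseteq> UA P Q \<psi> - \<Union>\<R>" for \<psi> and \<R> :: "(real^'n^'m) set set"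
  proof -
    have "UA P Q' \<psi> \<subseteq> UA P Q \<psi>"
      unfolding UA_def using Q'(1) by (intro Collect_mono impI) (erule eventually_mono, blast)
    then show ?thesis by blast
  qed
  have "mat_fibres P Q' \<subseteq> mat_fibres P Q"
    using Q'(1) by (auto simp: mat_fibres_def)
  moreover have "totally_dense (mat_fibres P Q')"
  proof (rule totally_dense_mat_fibres[OF tr])
    show "0 \<notin> Q'" using Q'(1) assms(7) by blast
  qed (rule dense)
  ultimately have "\<exists>\<L> \<subseteq> mat_fibres P Q. totally_dense \<L>" by blast
  moreover have main: "uncountable (UA P Q \<psi> - \<Union>\<R>) \<and> closure (UA P Q \<psi> - \<Union>\<R>) = UNIV"
    if "\<forall>t>0. \<psi> t > 0" "antimono_on {0<..} \<psi>" "countable \<R>" "\<forall>R\<in>\<R>. proper_analytic_submanifold R"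
    for \<psi> :: "real \<Rightarrow> real" and \<R> :: "(real^'n^'m) set set"
  proof -
    have "uncountable (UA P Q' \<psi> - \<Union>\<R>) \<and> closure (UA P Q' \<psi> - \<Union>\<R>) = UNIV"
      by (rule UA_Diff_submanifolds[OF tr]) (use that dense in simp_all)
    moreover have "closure (UA P Q' \<psi> - \<Union>\<R>) \<subseteq> closure (UA P Q \<psi> - \<Union>\<R>)"
      using UA_mono by (rule closure_mono)
    ultimately show ?thesis
      by (metis UA_mono countable_subset top.extremum_uniqueI)
  qed
  ultimately show ?thesis
    by (intro conjI[OF _ allI[OF allI]] impI main)
qed

end
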